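(* Given a directed acyclic graph $G$ with $n$ vertices and $m$ arcs, and a vertex $s \in G$, one can construct in time $O(m)$ a data structure for disjoint sets that allows one to answer in constant time, for any pair of vertices $u, v \in G$, whether $s$ is or is not a junction of $u, v$. Moreover, after this construction, all pairs of vertices that have $s$ as a junction can be printed out in $O(k)$ time, where $k$ is the number of such pairs.
   Context: All paths are directed, and a single vertex counts as a (trivial) directed path. For distinct vertices $u,v$ of a directed acyclic graph $G$, a vertex $s\in G$ is a junction of $u,v$ if there are internally disjoint directed paths $P$ from $s$ to $u$ and $Q$ from $s$ to $v$ in $G$, where internally disjoint means that $s$ is the only vertex common to $P$ and $Q$. In particular, if $u$ is a proper ancestor of $v$, then $u$ is a junction of $u,v$. By convention no vertex is a junction of a pair $u,u$. A data structure for disjoint sets stores a partition of a set of vertices, each block being identified by one of its elements (its representative). *)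

theory Defs
  imports "Graph_Theory.Pair_Digraph" "HOL-Library.Disjoint_Sets"
begin

section \<open>Junctions in directed acyclic graphs\<close>

locale dag = pair_fin_digraph G for G :: "'a pair_pre_digraph" +
  assumes no_cycle: "\<not> pre_digraph.cycle (with_proj G) p"

text \<open>
  The empty arc list is the trivial path at a vertex, so a proper ancestor \<open>u\<close> of \<open>v\<close> is a
  junction of \<open>u, v\<close>.
\<close>

definition junction :: "'a pair_pre_digraph \<Rightarrow> 'a \<Rightarrow> 'a \<Rightarrow> 'a \<Rightarrow> bool" where
  "junction G s u v \<longleftrightarrow> u \<noteq> v \<and>
     (\<exists>p q. pre_digraph.apath (with_proj G) s p u \<and> pre_digraph.apath (with_proj G) s q v \<and>
            set (pre_digraph.awalk_verts (with_proj G) s p) \<inter>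
            set (pre_digraph.awalk_verts (with_proj G) s q) = {s})"

definition junction_pairs :: "'a pair_pre_digraph \<Rightarrow> 'a \<Rightarrow> 'a set set" where
  "junction_pairs G s = {{u, v} | u v. junction G s u v}"


section \<open>The machine model\<close>

text \<open>
  Running times are counted on a unit-cost random access machine, programmed in a structured
  language: finitely many registers and finitely many unbounded arrays (those named in the
  program), holding natural numbers. The only arithmetic is increment and decrement, so within
  \<open>t\<close> steps no number exceeds the initial ones and the constants of the program by more than
  \<open>t\<close>; unit cost therefore cannot be exploited by computing with long numbers.
\<close>

type_synonym vname = string

record state =
  reg :: "vname \<Rightarrow> nat"
  arr :: "vname \<Rightarrow> nat \<Rightarrow> nat"
  out :: "(nat \<times> nat) list"

datatype test = Less vname vname | Equal vname vname

datatype com =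
    Skip
  | Const vname nat            \<comment> \<open>\<open>x := k\<close>\<close>
  | Copy vname vname           \<comment> \<open>\<open>x := y\<close>\<close>
  | Inc vname
  | Dec vname
  | Load vname vname vname     \<comment> \<open>\<open>x := a[y]\<close>\<close>
  | Store vname vname vname    \<comment> \<open>\<open>a[x] := y\<close>\<close>
  | Print vname vname
  | Seq com com
  | Cond test com com
  | While test com

fun holds :: "test \<Rightarrow> state \<Rightarrow> bool" where
  "holds (Less x y) \<sigma> \<longleftrightarrow> reg \<sigma> x < reg \<sigma> y"
| "holds (Equal x y) \<sigma> \<longleftrightarrow> reg \<sigma> x = reg \<sigma> y"

definition set_reg :: "vname \<Rightarrow> nat \<Rightarrow> state \<Rightarrow> state" where
  "set_reg x k \<sigma> = \<sigma>\<lparr>reg := (reg \<sigma>)(x := k)\<rparr>"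

text \<open>\<open>exec c \<sigma> t \<sigma>'\<close>: started in \<open>\<sigma>\<close>, the program \<open>c\<close> halts in \<open>\<sigma>'\<close> after exactly \<open>t\<close> steps.\<close>

inductive exec :: "com \<Rightarrow> state \<Rightarrow> nat \<Rightarrow> state \<Rightarrow> bool" where
  Skip: "exec Skip \<sigma> 1 \<sigma>"
| Const: "exec (Const x k) \<sigma> 1 (set_reg x k \<sigma>)"
| Copy: "exec (Copy x y) \<sigma> 1 (set_reg x (reg \<sigma> y) \<sigma>)"
| Inc: "exec (Inc x) \<sigma> 1 (set_reg x (reg \<sigma> x + 1) \<sigma>)"
| Dec: "exec (Dec x) \<sigma> 1 (set_reg x (reg \<sigma> x - 1) \<sigma>)"
| Load: "exec (Load x a y) \<sigma> 1 (set_reg x (arr \<sigma> a (reg \<sigma> y)) \<sigma>)"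
| Store: "exec (Store a x y) \<sigma> 1
            (\<sigma>\<lparr>arr := (arr \<sigma>)(a := (arr \<sigma> a)(reg \<sigma> x := reg \<sigma> y))\<rparr>)"
| Print: "exec (Print x y) \<sigma> 1 (\<sigma>\<lparr>out := out \<sigma> @ [(reg \<sigma> x, reg \<sigma> y)]\<rparr>)"
| Seq: "exec c \<sigma> t \<sigma>' \<Longrightarrow> exec d \<sigma>' t' \<sigma>'' \<Longrightarrow> exec (Seq c d) \<sigma> (t + t') \<sigma>''"
| CondTrue: "holds b \<sigma> \<Longrightarrow> exec c \<sigma> t \<sigma>' \<Longrightarrow> exec (Cond b c d) \<sigma> (t + 1) \<sigma>'"
| CondFalse: "\<not> holds b \<sigma> \<Longrightarrow> exec d \<sigma> t \<sigma>' \<Longrightarrow> exec (Cond b c d) \<sigma> (t + 1) \<sigma>'"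
| WhileFalse: "\<not> holds b \<sigma> \<Longrightarrow> exec (While b c) \<sigma> 1 \<sigma>"
| WhileTrue: "holds b \<sigma> \<Longrightarrow> exec c \<sigma> t \<sigma>' \<Longrightarrow> exec (While b c) \<sigma>' t' \<sigma>'' \<Longrightarrow>
              exec (While b c) \<sigma> (t + t' + 1) \<sigma>''"

lemma exec_determ:
  "exec c \<sigma> t \<sigma>1 \<Longrightarrow> exec c \<sigma> t' \<sigma>2 \<Longrightarrow> t' = t \<and> \<sigma>2 = \<sigma>1"
proof (induction arbitrary: t' \<sigma>2 rule: exec.induct)
  case (Seq c \<sigma> t \<sigma>' d u \<sigma>'')
  from Seq.prems show ?case by (cases) (use Seq.IH in blast)
next
  case (CondTrue b \<sigma> c t \<sigma>' d)
  from CondTrue.prems show ?case by (cases) (use CondTrue in blast)+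
next
  case (CondFalse b \<sigma> d t \<sigma>' c)
  from CondFalse.prems show ?case by (cases) (use CondFalse in blast)+
next
  case (WhileTrue b \<sigma> c t \<sigma>' u \<sigma>'')
  from WhileTrue.prems show ?case by (cases) (use WhileTrue in blast)+
qed (erule exec.cases; simp)+

definition halts_within :: "com \<Rightarrow> state \<Rightarrow> nat \<Rightarrow> (state \<Rightarrow> bool) \<Rightarrow> bool" where
  "halts_within c \<sigma> T Q \<longleftrightarrow> (\<exists>t \<sigma>'. exec c \<sigma> t \<sigma>' \<and> t \<le> T \<and> Q \<sigma>')"


section \<open>Input format and disjoint sets\<close>

text \<open>
  The vertices are numbered \<open>0, \<dots>, n - 1\<close>, and \<open>A ! v\<close> lists the out-neighbours of \<open>v\<close> without
  repetition, in any order.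
\<close>

definition adjacency_lists :: "nat pair_pre_digraph \<Rightarrow> nat list list \<Rightarrow> bool" where
  "adjacency_lists G A \<longleftrightarrow> pverts G = {..<length A} \<and>
     (\<forall>v<length A. distinct (A ! v) \<and> set (A ! v) = {w. (v, w) \<in> parcs G})"

text \<open>
  The out-neighbours of \<open>v\<close> are \<open>adj[off[v]], \<dots>, adj[off[v+1] - 1]\<close>. All registers and array
  cells that do not hold the input are initially \<open>0\<close>.
\<close>

definition input_state :: "nat list list \<Rightarrow> nat \<Rightarrow> state" where
  "input_state A s = \<lparr>
     reg = (\<lambda>_. 0)(''n'' := length A, ''s'' := s),
     arr = (\<lambda>_ _. 0)(
       ''off'' := (\<lambda>i. if i \<le> length A then length (concat (take i A)) else 0),
       ''adj'' := (\<lambda>i. if i < length (concat A) then concat A ! i else 0)),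
     out = []\<rparr>"

text \<open>
  In every state of \<open>S\<close> the memory holds a partition \<open>P\<close> of a set \<open>D\<close> of vertices from \<open>U\<close>,
  the block \<open>B\<close> having the representative \<open>rep B\<close>. The operation \<open>find_op\<close>, with its argument in
  the register \<open>u\<close>, decides membership in \<open>D\<close> and returns the representative of the block. It
  may reorganize the memory as long as it stays in \<open>S\<close>.
\<close>

definition stores_partition ::
  "com \<Rightarrow> nat \<Rightarrow> state set \<Rightarrow> nat set \<Rightarrow> nat set \<Rightarrow> nat set set \<Rightarrow> (nat set \<Rightarrow> nat) \<Rightarrow> bool" where
  "stores_partition find_op c S U D P rep \<longleftrightarrow>
     D \<subseteq> U \<and> partition_on D P \<and> (\<forall>B\<in>P. rep B \<in> B) \<and>
     (\<forall>\<sigma>\<in>S. \<forall>v\<in>U. halts_within find_op (set_reg ''u'' v \<sigma>) c (\<lambda>\<sigma>'.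
        \<sigma>' \<in> S \<and> out \<sigma>' = out \<sigma> \<and>
        reg \<sigma>' ''member'' = of_bool (v \<in> D) \<and>
        (\<forall>B\<in>P. v \<in> B \<longrightarrow> reg \<sigma>' ''rep'' = rep B)))"

end

theory Submission
  imports Defs
begin

text \<open>
  The label of a reachable vertex \<open>v \<noteq> s\<close> is the first vertex after \<open>s\<close> that lies on all paths from
  \<open>s\<close> to \<open>v\<close>, the child of \<open>s\<close> above \<open>v\<close> in the dominator tree; the label of \<open>s\<close> is \<open>s\<close>. Two paths from
  \<open>s\<close> to vertices with the same label meet in this label. Conversely, if \<open>u\<close> and \<open>v\<close> have different
  labels and \<open>v\<close> is not topologically before \<open>u\<close>, then some predecessor of \<open>v\<close> has a label different
  from that of \<open>u\<close>, and a pair of disjoint paths to \<open>u\<close> and this predecessor extends to \<open>v\<close>. Hence the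
  reachable vertices, partitioned by label, are the required disjoint sets.

  The labels are computed in topological order: \<open>v\<close> inherits the common label of its reachable
  predecessors, and becomes a label itself if they disagree or if \<open>s\<close> is among them. For printing,
  the reachable vertices are kept in a circular list in which every block is contiguous and starts
  with its representative; the junction pairs are then the pairs of a vertex \<open>x\<close> and a vertex before
  the representative of \<open>x\<close>. Since \<open>s\<close> forms a pair with every other reachable vertex, running through
  the list costs no more than the output.
\<close>

section \<open>Branch labellings and junctions\<close>

definition reach :: "'a pair_pre_digraph \<Rightarrow> 'a \<Rightarrow> 'a set" where
  "reach G s = {v. (s, v) \<in> (parcs G)\<^sup>*}"

text \<open>Conditions along single arcs replace the description by paths, so that labels can be
  computed from those of the predecessors. Since \<open>r s = s\<close>, the restriction
  \<open>c ~= s\<close> makes the last clause vacuous whenever \<open>s\<close> precedes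
  \<open>v\<close>; the first clause then forces \<open>r v = v\<close>.\<close>

definition branch_labelling :: "'a pair_pre_digraph \<Rightarrow> 'a \<Rightarrow> ('a \<Rightarrow> 'a) \<Rightarrow> bool" where
  "branch_labelling G s r \<longleftrightarrow> r s = s \<and>
     (\<forall>v\<in>reach G s - {s}.
        (r v = v \<or> (\<forall>p\<in>reach G s. (p, v) \<in> parcs G \<longrightarrow> p \<noteq> s \<and> r p = r v)) \<and>
        (\<forall>c. c \<noteq> s \<longrightarrow> (\<forall>p\<in>reach G s. (p, v) \<in> parcs G \<longrightarrow> r p = c) \<longrightarrow> r v = c))"

lemma reach_self [simp]: "s \<in> reach G s"
  by (simp add: reach_def)

lemma reach_step: "p \<in> reach G s \<Longrightarrow> (p, v) \<in> parcs G \<Longrightarrow> v \<in> reach G s"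
  unfolding reach_def by (auto intro: rtrancl_into_rtrancl)

lemma reach_pred:
  assumes "v \<in> reach G s" "v \<noteq> s"
  obtains p where "p \<in> reach G s" "(p, v) \<in> parcs G"
  using assms unfolding reach_def by (auto elim: rtranclE)

section \<open>Acyclicity, depth and extension of paths\<close>

context dag
begin

lemma acyclic_arcs: "acyclic (parcs G)"
proof (rule acyclicI, rule allI, rule notI)
  fix v assume "(v, v) \<in> (parcs G)\<^sup>+"
  then obtain p where "awalk v p v" "p \<noteq> []"
    using reachable1_awalk by auto
  then show False
    using closed_w_imp_cycle no_cycle unfolding closed_w_def by blast
qed

lemma no_arc_to_root: "p \<in> reach G s \<Longrightarrow> (p, s) \<notin> parcs G"
  using acyclic_arcs unfolding acyclic_def reach_def by (meson mem_Collect_eq rtrancl_into_trancl1)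

lemma wf_arcs: "wf (parcs G)"
  using acyclic_arcs pair_finite_arcs by (simp add: finite_acyclic_wf)

text \<open>A numerical substitute for a topological order.\<close>

definition depth :: "'a \<Rightarrow> nat" where
  "depth v = card {x. (x, v) \<in> (parcs G)\<^sup>+}"

text \<open>Ancestors of \<open>x\<close> are ancestors of \<open>y\<close>. The inclusion is proper
  because \<open>x\<close> is an ancestor of \<open>y\<close> but, by acyclicity, not of
  itself.\<close>

lemma depth_less:
  assumes "(x, y) \<in> (parcs G)\<^sup>+"
  shows "depth x < depth y"
  unfolding depth_def
proof (rule psubset_card_mono)
  have "{z. (z, y) \<in> (parcs G)\<^sup>+} \<subseteq> fst ` parcs G"
    by (force dest: tranclD)
  then show "finite {z. (z, y) \<in> (parcs G)\<^sup>+}"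
    using pair_finite_arcs by (meson finite_imageI finite_subset)
  show "{z. (z, x) \<in> (parcs G)\<^sup>+} \<subset> {z. (z, y) \<in> (parcs G)\<^sup>+}"
    using assms acyclic_arcs by (auto simp: acyclic_def intro: trancl_trans)
qed

lemma awalk_imp_reach: "awalk s p v \<Longrightarrow> v \<in> reach G s"
  by (induction p arbitrary: s) (auto simp: awalk_simps reach_def intro: converse_rtrancl_into_rtrancl)

lemma reach_imp_apath:
  assumes "v \<in> reach G s" "s \<in> pverts G"
  obtains p where "apath s p v"
proof -
  obtain p where "awalk s p v"
  proof (cases "v = s")
    case True
    then show ?thesis using that[of "[]"] assms(2) by (simp add: awalk_Nil_iff)
  next
    case False
    then have "(s, v) \<in> (parcs G)\<^sup>+"
      using assms(1) by (auto simp: reach_def dest: rtranclD)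
    then show ?thesis using that reachable1_awalk by auto
  qed
  then show ?thesis
    using apath_awalk_to_apath that by blast
qed

lemma apath_snoc:
  assumes "apath s p x" "(x, v) \<in> parcs G" "v \<notin> set (pawalk_verts s p)"
  shows "apath s (p @ [(x, v)]) v \<and>
    set (pawalk_verts s (p @ [(x, v)])) = insert v (set (pawalk_verts s p))"
proof -
  have w: "awalk s p x" "distinct (pawalk_verts s p)"
    using assms(1) by (auto simp: apath_def)
  then have "awalk s (p @ [(x, v)]) v"
    using assms(2) by (auto simp: awalk_simps in_arcsD1 in_arcsD2)
  moreover from this have "pawalk_verts s (p @ [(x, v)]) = pawalk_verts s p @ [v]"
    using awalk_verts_append[of s p "[(x, v)]" v] w by simp
  ultimately show ?thesis
    using w assms(3) by (auto simp: apath_def)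
qed

section \<open>Labels decide which pairs have \<open>s\<close> as a junction\<close>

context
  fixes s :: 'a and r :: "'a \<Rightarrow> 'a"
  assumes root: "s \<in> pverts G" and lab: "branch_labelling G s r"
begin

text \<open>Induction on the last arc \<open>(x, v)\<close>: either \<open>v\<close> is its own
  label, or it shares the label of \<open>x\<close>, where \<open>x ~= s\<close>, and this label
  already lies on the shorter walk.\<close>

lemma label_on_awalk:
  assumes "awalk s p v" "v \<noteq> s"
  shows "r v \<in> set (pawalk_verts s p) \<and> r v \<noteq> s"
  using assms
proof (induction p arbitrary: v rule: rev_induct)
  case Nil
  then show ?case by (simp add: awalk_Nil_iff)
next
  case (snoc e p)
  obtain x where e: "e = (x, v)" "(x, v) \<in> parcs G" "awalk s p x"
    using snoc.prems(1) by (cases e) (auto simp: awalk_simps)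
  have verts: "pawalk_verts s (p @ [e]) = pawalk_verts s p @ [v]"
    using awalk_verts_append[of s p "[e]" v] snoc.prems(1) e by simp
  have x: "x \<in> reach G s" and v: "v \<in> reach G s"
    using awalk_imp_reach[OF e(3)] awalk_imp_reach[OF snoc.prems(1)] by auto
  consider "r v = v" | "x \<noteq> s" "r x = r v"
    using lab v x e(2) snoc.prems(2) unfolding branch_labelling_def by auto
  then show ?case
  proof cases
    case 1
    then show ?thesis using verts snoc.prems(2) by simp
  next
    case 2
    then show ?thesis using snoc.IH[OF e(3)] verts by simp
  qed
qed

lemma label_neq_root: "v \<in> reach G s \<Longrightarrow> v \<noteq> s \<Longrightarrow> r v \<noteq> s"
  using reach_imp_apath[OF _ root] label_on_awalk unfolding apath_def by blast

lemma depth_on_awalk: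
  assumes "awalk s p v" "y \<in> set (pawalk_verts s p)" "y \<noteq> v"
  shows "depth y < depth v"
proof -
  obtain q where "awalk y q v"
    using awalk_decomp[OF assms(1)] assms(2) by auto
  then have "(y, v) \<in> (parcs G)\<^sup>+"
    using assms(3) reachable1_awalk awalk_empty_ends by blast
  then show ?thesis
    by (rule depth_less)
qed

text \<open>Induction on the sum of the depths. Only the endpoint of larger depth is pulled back to
  a predecessor; the other order follows by swapping the two paths, and an endpoint \<open>s\<close>
  is served by the trivial path.\<close>

lemma disjoint_apaths:
  assumes "u \<in> reach G s" "v \<in> reach G s" "r u \<noteq> r v"
  shows "\<exists>p q. apath s p u \<and> apath s q v \<and>
            set (pawalk_verts s p) \<inter> set (pawalk_verts s q) = {s}"
  using assms
proof (induction "depth u + depth v" arbitrary: u v rule: less_induct)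
  case less
  let ?J = "\<lambda>u v. \<exists>p q. apath s p u \<and> apath s q v \<and>
            set (pawalk_verts s p) \<inter> set (pawalk_verts s q) = {s}"
  have sym: "?J v u \<Longrightarrow> ?J u v" for u v
    by (metis inf_commute)
  have trivial: "?J s v" if "v \<in> reach G s" for v
  proof -
    obtain q where "apath s q v"
      using reach_imp_apath \<open>v \<in> reach G s\<close> root by blast
    moreover have "apath s [] s"
      using root by (simp add: apath_Nil_iff)
    moreover have "s \<in> set (pawalk_verts s q)"
      by (cases q) (use \<open>apath s q v\<close> in \<open>auto simp: apath_Cons_iff\<close>)
    ultimately show ?thesis by fastforce
  qed
  have step: "?J u v"
    if uv: "u \<in> reach G s" "v \<in> reach G s" "r u \<noteq> r v" "u \<noteq> s" "v \<noteq> s" "depth u \<le> depth v"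
      and IH: "\<And>x. x \<in> reach G s \<Longrightarrow> r u \<noteq> r x \<Longrightarrow> depth x < depth v \<Longrightarrow> ?J u x"
    for u v
  proof -
    have "r u \<noteq> s"
      using label_neq_root uv(1,4) by blast
    \<comment> \<open>If all reachable predecessors of \<open>v\<close> had the label
      \<open>r u\<close>, the last clause of the labelling with \<open>c = r u\<close> would force
      \<open>r v = r u\<close>.\<close>
    then obtain x where x: "x \<in> reach G s" "(x, v) \<in> parcs G" "r x \<noteq> r u"
      using lab uv unfolding branch_labelling_def by (metis Diff_iff empty_iff insert_iff)
    then obtain p q where pq: "apath s p u" "apath s q x"
        "set (pawalk_verts s p) \<inter> set (pawalk_verts s q) = {s}"
      using IH depth_less by (metis r_into_trancl')
    \<comment> \<open>Otherwise \<open>v\<close> would be \<open>x\<close> or an ancestor of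
      \<open>x\<close>, against the arc from \<open>x\<close> to \<open>v\<close>.\<close>
    have "v \<notin> set (pawalk_verts s q)"
    proof
      assume "v \<in> set (pawalk_verts s q)"
      then have "depth v \<le> depth x"
        using depth_on_awalk[of q x v] pq(2) by (cases "v = x") (auto simp: apath_def)
      then show False
        using depth_less x(2) by (meson leD r_into_trancl')
    qed
    \<comment> \<open>A vertex \<open>v\<close> on the path to \<open>u\<close> would lie strictly
      above \<open>u\<close>, as \<open>r u ~= r v\<close> excludes \<open>u = v\<close>; but
      \<open>depth u <= depth v\<close>.\<close>
    moreover have "v \<notin> set (pawalk_verts s p)"
      using depth_on_awalk[of p u v] pq(1) uv(3,6) by (auto simp: apath_def)
    ultimately have "apath s (q @ [(x, v)]) v"
        "set (pawalk_verts s p) \<inter> set (pawalk_verts s (q @ [(x, v)])) = {s}"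
      using apath_snoc[OF pq(2) x(2)] pq(3) by auto
    then show ?thesis
      using pq(1) by blast
  qed
  consider "u = s" | "v = s" | "u \<noteq> s" "v \<noteq> s" "depth u \<le> depth v"
    | "u \<noteq> s" "v \<noteq> s" "depth v \<le> depth u"
    by linarith
  then show ?case
  proof cases
    case 1
    then show ?thesis using trivial less.prems(2) by simp
  next
    case 2
    then show ?thesis using sym[OF trivial] less.prems(1) by simp
  next
    case 3
    show ?thesis
      by (rule step) (use less 3 in simp_all)
  next
    case 4
    show ?thesis
    proof (rule sym, rule step)
      show "\<And>x. x \<in> reach G s \<Longrightarrow> r v \<noteq> r x \<Longrightarrow> depth x < depth u \<Longrightarrow> ?J v x"
        using less.hyps less.prems(2) by simp
    qed (use less.prems 4 in simp_all)
  qed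
qed

text \<open>A common label would lie on both paths and differ from \<open>s\<close>, against
  disjointness. If one endpoint is \<open>s\<close>, its label \<open>s\<close> differs from the
  label of the other. The converse is \<open>disjoint_apaths\<close>.\<close>

lemma junction_iff_label_neq:
  "junction G s u v \<longleftrightarrow> u \<in> reach G s \<and> v \<in> reach G s \<and> r u \<noteq> r v"
proof
  assume "junction G s u v"
  then obtain p q where pq: "u \<noteq> v" "apath s p u" "apath s q v"
      "set (pawalk_verts s p) \<inter> set (pawalk_verts s q) = {s}"
    by (auto simp: junction_def)
  then have w: "awalk s p u" "awalk s q v"
    by (auto simp: apath_def)
  have "r u \<noteq> r v"
  proof (cases "u = s \<or> v = s")
    case True
    moreover have "r s = s"
      using lab by (simp add: branch_labelling_def)
    ultimately show ?thesis
      using label_on_awalk[OF w(1)] label_on_awalk[OF w(2)] pq(1) by metis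
  next
    case False
    then have "r u \<in> set (pawalk_verts s p)" "r v \<in> set (pawalk_verts s q)" "r v \<noteq> s"
      using label_on_awalk[OF w(1)] label_on_awalk[OF w(2)] by blast+
    then show ?thesis
      using pq(4) by (metis IntI singletonD)
  qed
  then show "u \<in> reach G s \<and> v \<in> reach G s \<and> r u \<noteq> r v"
    using awalk_imp_reach[OF w(1)] awalk_imp_reach[OF w(2)] by simp
next
  assume *: "u \<in> reach G s \<and> v \<in> reach G s \<and> r u \<noteq> r v"
  then have "u \<noteq> v"
    by blast
  with * show "junction G s u v"
    using disjoint_apaths[of u v] by (simp add: junction_def awalk_verts_with_proj_eq)
qed

end
end


section \<open>Straight-line programs and loops\<close>

notation Seq (infixr ";;" 60)

fun straight :: "com \<Rightarrow> bool" where
  "straight (c ;; d) \<longleftrightarrow> straight c \<and> straight d"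
| "straight (Cond b c d) \<longleftrightarrow> straight c \<and> straight d"
| "straight (While b c) \<longleftrightarrow> False"
| "straight _ \<longleftrightarrow> True"

text \<open>An upper bound rather than the exact time: a conditional is charged for both branches.
  The value for \<open>While\<close> is a dummy.\<close>

fun steps :: "com \<Rightarrow> nat" where
  "steps (c ;; d) = steps c + steps d"
| "steps (Cond b c d) = steps c + steps d + 1"
| "steps _ = 1"

text \<open>\<open>run\<close> is meaningful on loop-free programs only; the clause for \<open>While\<close> is a dummy.\<close>

fun run :: "com \<Rightarrow> state \<Rightarrow> state" where
  "run Skip \<sigma> = \<sigma>"
| "run (Const x k) \<sigma> = set_reg x k \<sigma>"
| "run (Copy x y) \<sigma> = set_reg x (reg \<sigma> y) \<sigma>"
| "run (Inc x) \<sigma> = set_reg x (reg \<sigma> x + 1) \<sigma>"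
| "run (Dec x) \<sigma> = set_reg x (reg \<sigma> x - 1) \<sigma>"
| "run (Load x a y) \<sigma> = set_reg x (arr \<sigma> a (reg \<sigma> y)) \<sigma>"
| "run (Store a x y) \<sigma> = \<sigma>\<lparr>arr := (arr \<sigma>)(a := (arr \<sigma> a)(reg \<sigma> x := reg \<sigma> y))\<rparr>"
| "run (Print x y) \<sigma> = \<sigma>\<lparr>out := out \<sigma> @ [(reg \<sigma> x, reg \<sigma> y)]\<rparr>"
| "run (c ;; d) \<sigma> = run d (run c \<sigma>)"
| "run (Cond b c d) \<sigma> = (if holds b \<sigma> then run c \<sigma> else run d \<sigma>)"
| "run (While b c) \<sigma> = \<sigma>"

lemma set_reg_simps [simp]:
  "reg (set_reg x k \<sigma>) = (reg \<sigma>)(x := k)"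
  "arr (set_reg x k \<sigma>) = arr \<sigma>"
  "out (set_reg x k \<sigma>) = out \<sigma>"
  by (simp_all add: set_reg_def)

lemma exec_straight: "straight c \<Longrightarrow> \<exists>t\<le>steps c. exec c \<sigma> t (run c \<sigma>)"
proof (induction c arbitrary: \<sigma>)
  case (Seq c d)
  then obtain t t' where "t \<le> steps c" "exec c \<sigma> t (run c \<sigma>)"
      "t' \<le> steps d" "exec d (run c \<sigma>) t' (run d (run c \<sigma>))"
    by (meson straight.simps(1))
  then show ?case
    by (auto intro!: exI[of _ "t + t'"] exec.Seq)
next
  case (Cond b c d)
  show ?case
  proof (cases "holds b \<sigma>")
    case True
    then obtain t where "t \<le> steps c" "exec c \<sigma> t (run c \<sigma>)"
      using Cond by auto
    with True show ?thesis
      by (auto intro!: exI[of _ "t + 1"] exec.CondTrue[simplified])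
  next
    case False
    then obtain t where "t \<le> steps d" "exec d \<sigma> t (run d \<sigma>)"
      using Cond by auto
    with False show ?thesis
      by (auto intro!: exI[of _ "t + 1"] exec.CondFalse[simplified])
  qed
qed (auto intro!: exI[of _ "Suc 0"] exec.intros[simplified])

lemma halts_straight:
  assumes "straight c" "steps c \<le> T" "Q (run c \<sigma>)"
  shows "halts_within c \<sigma> T Q"
  using exec_straight[OF assms(1)] assms(2,3) unfolding halts_within_def by (meson order_trans)

lemma halts_Seq:
  assumes "halts_within c \<sigma> T R" "\<And>\<sigma>'. R \<sigma>' \<Longrightarrow> halts_within d \<sigma>' T' Q"
  shows "halts_within (c ;; d) \<sigma> (T + T') Q"
proof -
  obtain t \<sigma>' where "exec c \<sigma> t \<sigma>'" "t \<le> T" "R \<sigma>'"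
    using assms(1) by (auto simp: halts_within_def)
  moreover from this obtain t' \<sigma>'' where "exec d \<sigma>' t' \<sigma>''" "t' \<le> T'" "Q \<sigma>''"
    using assms(2)[of \<sigma>'] by (auto simp: halts_within_def)
  ultimately show ?thesis
    using exec.Seq unfolding halts_within_def by (meson add_mono)
qed

lemma halts_mono:
  assumes "halts_within c \<sigma> T Q" "T \<le> T'" "\<And>\<sigma>'. Q \<sigma>' \<Longrightarrow> R \<sigma>'"
  shows "halts_within c \<sigma> T' R"
  using assms unfolding halts_within_def by (meson order_trans)

text \<open>The index \<open>n\<close> of the invariant is the variant, so there are at most
  \<open>n\<close> rounds. Each costs at most \<open>steps c + 1\<close>, the extra step paying for
  the test, and the last, failing test costs 1.\<close>

lemma halts_While:
  assumes "straight c" "I n \<sigma>"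
    and step: "\<And>n \<sigma>. I n \<sigma> \<Longrightarrow> holds b \<sigma> \<Longrightarrow> \<exists>n'<n. I n' (run c \<sigma>)"
  shows "halts_within (While b c) \<sigma> (n * (steps c + 1) + 1) (\<lambda>\<sigma>'. \<not> holds b \<sigma>' \<and> (\<exists>n. I n \<sigma>'))"
  using assms(2)
proof (induction n arbitrary: \<sigma> rule: less_induct)
  case (less n)
  show ?case
  proof (cases "holds b \<sigma>")
    case True
    then obtain n' where n': "n' < n" "I n' (run c \<sigma>)"
      using step less.prems by blast
    then obtain t' \<sigma>' where t': "exec (While b c) (run c \<sigma>) t' \<sigma>'" "t' \<le> n' * (steps c + 1) + 1"
        "\<not> holds b \<sigma>'" "\<exists>n. I n \<sigma>'"
      using less.IH unfolding halts_within_def by blast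
    obtain t where t: "t \<le> steps c" "exec c \<sigma> t (run c \<sigma>)"
      using exec_straight[OF assms(1)] by blast
    have "(n' + 1) * (steps c + 1) \<le> n * (steps c + 1)"
      using n'(1) by (intro mult_le_mono1) simp
    then have "t + t' + 1 \<le> n * (steps c + 1) + 1"
      using t(1) t'(2) by (simp add: algebra_simps)
    then show ?thesis
      using exec.WhileTrue[OF True t(2) t'(1)] t'(3,4) unfolding halts_within_def by blast
  next
    case False
    then show ?thesis
      using exec.WhileFalse[OF False] less.prems unfolding halts_within_def
      by (intro exI[of _ 1] exI[of _ \<sigma>]) auto
  qed
qed


section \<open>Traversal by a queue\<close>

text \<open>
  One step of a queue-driven search: the arc from \<open>x\<close> to \<open>w = adj[j]\<close> is passed to \<open>act\<close>, which may
  append \<open>w\<close> to the queue \<open>q[0], \<dots>, q[t - 1]\<close>. As the language has no negated tests, the flag \<open>f\<close>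
  ends the loop.
\<close>

definition visit :: "com \<Rightarrow> com" where
  "visit act = Cond (Less ''j'' ''e'')
     (Load ''w'' ''adj'' ''j'' ;; Inc ''j'' ;; act)
     (Cond (Less ''h'' ''t'')
        (Load ''x'' ''q'' ''h'' ;; Inc ''h'' ;; Load ''j'' ''off'' ''x'' ;;
         Copy ''y'' ''x'' ;; Inc ''y'' ;; Load ''e'' ''off'' ''y'')
        (Const ''f'' 1))"

text \<open>With \<open>j = e\<close> no arc is pending, so the first visit takes \<open>s\<close>
  from the queue. The register \<open>zero\<close> serves as the index of the first cell.\<close>

definition traverse_init :: com where
  "traverse_init = Const ''h'' 0 ;; Const ''j'' 0 ;; Const ''e'' 0 ;; Const ''f'' 0 ;;
     Const ''t'' 1 ;; Store ''q'' ''zero'' ''s''"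

definition traverse :: "com \<Rightarrow> com" where
  "traverse act = traverse_init ;; While (Equal ''f'' ''zero'') (visit act)"

text \<open>Every reachable vertex except \<open>s\<close> is the head of an arc. This bounds the
  work by the number of arcs alone, whatever the number of vertices.\<close>

lemma card_reach_le: "finite (parcs G) \<Longrightarrow> card (reach G s) \<le> card (parcs G) + 1"
proof -
  assume fin: "finite (parcs G)"
  have "reach G s \<subseteq> insert s (snd ` parcs G)"
  proof
    fix v assume "v \<in> reach G s"
    then show "v \<in> insert s (snd ` parcs G)"
      by (metis reach_pred image_eqI insert_iff snd_conv)
  qed
  then have "card (reach G s) \<le> card (insert s (snd ` parcs G))"
    using fin by (intro card_mono) auto
  also have "\<dots> \<le> card (parcs G) + 1"
    using card_image_le[OF fin, of snd] by (simp add: fin card_insert_if)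
  finally show ?thesis .
qed

section \<open>Input arrays, the queue and the position of the scan\<close>

locale rooted_dag = dag G for G :: "nat pair_pre_digraph" +
  fixes A :: "nat list list" and s :: nat
  assumes adj: "adjacency_lists G A" and root_in: "s \<in> pverts G"
begin

lemma arc_iff: "x \<in> pverts G \<Longrightarrow> (x, w) \<in> parcs G \<longleftrightarrow> w \<in> set (A ! x)"
  using adj by (auto simp: adjacency_lists_def)

lemma reach_subset: "reach G s \<subseteq> pverts G"
proof
  fix v assume "v \<in> reach G s"
  then show "v \<in> pverts G"
    by (metis reach_pred root_in in_arcsD2)
qed

definition offset :: "nat \<Rightarrow> nat" where
  "offset x = length (concat (take x A))"

text \<open>The part of the memory that every phase of the construction preserves.\<close>

definition loaded :: "state \<Rightarrow> bool" where
  "loaded \<sigma> \<longleftrightarrow> arr \<sigma> ''off'' = arr (input_state A s) ''off'' \<and>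
     arr \<sigma> ''adj'' = arr (input_state A s) ''adj'' \<and>
     reg \<sigma> ''s'' = s \<and> reg \<sigma> ''zero'' = 0 \<and> out \<sigma> = []"

lemma loaded_off: "loaded \<sigma> \<Longrightarrow> x \<le> length A \<Longrightarrow> arr \<sigma> ''off'' x = offset x"
  by (simp add: loaded_def input_state_def offset_def)

lemma loaded_adj:
  assumes "loaded \<sigma>" "x < length A" "k < length (A ! x)"
  shows "arr \<sigma> ''adj'' (offset x + k) = A ! x ! k"
proof -
  have "concat A = concat (take x A) @ A ! x @ concat (drop (Suc x) A)"
    using assms(2) by (metis concat.simps(2) concat_append id_take_nth_drop)
  then show ?thesis
    using assms by (simp add: loaded_def input_state_def offset_def nth_append)
qed

lemma offset_Suc: "x < length A \<Longrightarrow> offset (Suc x) = offset x + length (A ! x)"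
  by (simp add: offset_def take_Suc_conv_app_nth)

definition queue :: "state \<Rightarrow> nat list \<Rightarrow> bool" where
  "queue \<sigma> Q \<longleftrightarrow> reg \<sigma> ''t'' = length Q \<and> (\<forall>i<length Q. arr \<sigma> ''q'' i = Q ! i)"

text \<open>\<open>E\<close> is the set of arcs handled so far. The register \<open>h\<close> is one
  ahead of the index of the vertex being scanned; the first alternative covers the start, when no
  vertex has been taken from the queue.\<close>

definition position :: "nat list \<Rightarrow> (nat \<times> nat) set \<Rightarrow> state \<Rightarrow> bool" where
  "position Q E \<sigma> \<longleftrightarrow>
     reg \<sigma> ''h'' = 0 \<and> reg \<sigma> ''j'' = reg \<sigma> ''e'' \<and> E = {} \<or>
     (\<exists>h x k. reg \<sigma> ''h'' = Suc h \<and> h < length Q \<and> x = Q ! h \<and> reg \<sigma> ''x'' = x \<and>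
        k \<le> length (A ! x) \<and> reg \<sigma> ''j'' = offset x + k \<and> reg \<sigma> ''e'' = offset x + length (A ! x) \<and>
        E = {(y, z). y \<in> set (take h Q) \<and> z \<in> set (A ! y)} \<union> {x} \<times> set (take k (A ! x)))"

lemma position_mono:
  assumes "position Q E \<sigma>" shows "position (Q @ Q') E \<sigma>"
  using assms unfolding position_def by (fastforce simp: nth_append)

lemma position_pop:
  assumes "position Q E \<sigma>" "\<not> reg \<sigma> ''j'' < reg \<sigma> ''e''"
  shows "reg \<sigma> ''h'' \<le> length Q" "E = {(y, z). y \<in> set (take (reg \<sigma> ''h'') Q) \<and> z \<in> set (A ! y)}"
proof -
  show "reg \<sigma> ''h'' \<le> length Q"
    using assms unfolding position_def by auto
  show "E = {(y, z). y \<in> set (take (reg \<sigma> ''h'') Q) \<and> z \<in> set (A ! y)}"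
    using assms(1) unfolding position_def
  proof (elim disjE exE conjE)
    fix h x k
    assume "reg \<sigma> ''h'' = Suc h" "h < length Q" "x = Q ! h" "k \<le> length (A ! x)"
      "reg \<sigma> ''j'' = offset x + k" "reg \<sigma> ''e'' = offset x + length (A ! x)"
      "E = {(y, z). y \<in> set (take h Q) \<and> z \<in> set (A ! y)} \<union> {x} \<times> set (take k (A ! x))"
    then show ?thesis
      using assms(2) by (auto simp: take_Suc_conv_app_nth)
  qed simp
qed

lemma position_arcs:
  assumes "position Q E \<sigma>" "set Q \<subseteq> reach G s"
  shows "E \<subseteq> {(x, w) \<in> parcs G. x \<in> set Q}"
proof -
  have "set Q \<subseteq> pverts G"
    using assms(2) reach_subset by blast
  then show ?thesis
    using assms(1) unfolding position_def
    by (auto dest!: in_set_takeD) (meson arc_iff nth_mem subsetD in_set_takeD)+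
qed

text \<open>The arc is new because neither the queue nor an adjacency list has repetitions; this
  makes the number of handled arcs a measure of progress.\<close>

lemma position_advance:
  assumes "position Q E \<sigma>" "reg \<sigma> ''j'' < reg \<sigma> ''e''" "loaded \<sigma>"
    and Q: "distinct Q" "set Q \<subseteq> reach G s"
    and \<sigma>1: "\<sigma>1 = run (Load ''w'' ''adj'' ''j'' ;; Inc ''j'') \<sigma>"
  shows "reg \<sigma>1 ''x'' \<in> set Q" "(reg \<sigma>1 ''x'', reg \<sigma>1 ''w'') \<in> parcs G - E"
    "position Q (insert (reg \<sigma>1 ''x'', reg \<sigma>1 ''w'') E) \<sigma>1"
proof -
  obtain h x k where p: "reg \<sigma> ''h'' = Suc h" "h < length Q" "x = Q ! h" "reg \<sigma> ''x'' = x"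
      "k < length (A ! x)" "reg \<sigma> ''j'' = offset x + k" "reg \<sigma> ''e'' = offset x + length (A ! x)"
      "E = {(y, z). y \<in> set (take h Q) \<and> z \<in> set (A ! y)} \<union> {x} \<times> set (take k (A ! x))"
    using assms(1,2) unfolding position_def by auto
  have x: "x \<in> pverts G" "x < length A" "distinct (A ! x)"
    using subsetD[OF subset_trans[OF Q(2) reach_subset], of x] p(2,3) adj
    by (auto simp: adjacency_lists_def)
  have w: "reg \<sigma>1 ''w'' = A ! x ! k" "reg \<sigma>1 ''x'' = x"
    using loaded_adj[OF assms(3) x(2) p(5)] p by (simp_all add: \<sigma>1)
  have "x \<notin> set (take h Q)"
    using distinct_take[OF Q(1), of "Suc h"] p(2,3) by (simp add: take_Suc_conv_app_nth)
  moreover have "A ! x ! k \<notin> set (take k (A ! x))"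
    using distinct_take[OF x(3), of "Suc k"] p(5) by (simp add: take_Suc_conv_app_nth)
  ultimately show "(reg \<sigma>1 ''x'', reg \<sigma>1 ''w'') \<in> parcs G - E"
    using w p(5,8) x(1) by (auto simp: arc_iff)
  show "reg \<sigma>1 ''x'' \<in> set Q"
    using w p by simp
  show "position Q (insert (reg \<sigma>1 ''x'', reg \<sigma>1 ''w'') E) \<sigma>1"
  proof -
    have "insert (x, A ! x ! k) E =
        {(y, z). y \<in> set (take h Q) \<and> z \<in> set (A ! y)} \<union> {x} \<times> set (take (Suc k) (A ! x))"
      unfolding p(8) take_Suc_conv_app_nth[OF p(5)] by auto
    then show ?thesis
      unfolding position_def w using p(1-7)
      by (intro disjI2 exI[of _ h] exI[of _ x] exI[of _ "Suc k"]) (simp add: \<sigma>1)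
  qed
qed

lemma position_next:
  assumes "position Q E \<sigma>" "\<not> reg \<sigma> ''j'' < reg \<sigma> ''e''" "reg \<sigma> ''h'' < length Q" "loaded \<sigma>"
    "queue \<sigma> Q" "set Q \<subseteq> reach G s"
    and \<sigma>1: "\<sigma>1 = run (Load ''x'' ''q'' ''h'' ;; Inc ''h'' ;; Load ''j'' ''off'' ''x'' ;;
         Copy ''y'' ''x'' ;; Inc ''y'' ;; Load ''e'' ''off'' ''y'') \<sigma>"
  shows "position Q E \<sigma>1"
proof -
  let ?x = "Q ! reg \<sigma> ''h''"
  have "?x \<in> pverts G"
    using assms(3,6) reach_subset by (meson nth_mem subsetD)
  then have x: "?x < length A"
    using adj by (simp add: adjacency_lists_def)
  show ?thesis
    \<comment> \<open>The vertex just taken starts with \<open>k = 0\<close>: none of its arcs is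
      handled, while all arcs of the earlier entries are.\<close>
    unfolding position_def
    by (intro disjI2 exI[of _ "reg \<sigma> ''h''"] exI[of _ ?x] exI[of _ 0])
      (use assms x position_pop(2)[OF assms(1,2)] in
        \<open>auto simp: \<sigma>1 queue_def loaded_off offset_Suc\<close>)
qed

text \<open>The contract between \<open>visit\<close> and an action: \<open>I\<close> relates queue,
  handled arcs and arrays, and survives every new arc out of the queue. It reads no registers, so
  the bookkeeping of \<open>visit\<close> cannot break it. Distinct queue entries within
  \<open>reach G s\<close> bound the number of vertices taken.\<close>

definition act_ok :: "com \<Rightarrow> (nat list \<Rightarrow> (nat \<times> nat) set \<Rightarrow> (vname \<Rightarrow> nat \<Rightarrow> nat) \<Rightarrow> bool) \<Rightarrow> bool" where
  "act_ok act I \<longleftrightarrow> straight act \<and>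
     (\<forall>Q E a. I Q E a \<longrightarrow> distinct Q \<and> set Q \<subseteq> reach G s) \<and>
     (\<forall>Q E \<sigma> x w. I Q E (arr \<sigma>) \<longrightarrow> loaded \<sigma> \<longrightarrow> queue \<sigma> Q \<longrightarrow>
        reg \<sigma> ''x'' = x \<longrightarrow> reg \<sigma> ''w'' = w \<longrightarrow> x \<in> set Q \<longrightarrow> (x, w) \<in> parcs G - E \<longrightarrow>
        E \<subseteq> {(x, w) \<in> parcs G. x \<in> set Q} \<longrightarrow>
        loaded (run act \<sigma>) \<and>
        (\<forall>z\<in>{''h'', ''j'', ''e'', ''f'', ''x''}. reg (run act \<sigma>) z = reg \<sigma> z) \<and>
        (\<exists>Q'. I (Q @ Q') (insert (x, w) E) (arr (run act \<sigma>)) \<and> queue (run act \<sigma>) (Q @ Q')))"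

text \<open>The variant adds the unhandled arcs, an upper bound for the vertices still to be taken,
  and 1 for setting the flag.\<close>

definition traverse_inv where
  "traverse_inv I n \<sigma> \<longleftrightarrow> loaded \<sigma> \<and> (\<exists>Q E. I Q E (arr \<sigma>) \<and> queue \<sigma> Q \<and> position Q E \<sigma> \<and>
     (reg \<sigma> ''f'' = 0 \<and>
        n = (card (parcs G) - card E) + (card (parcs G) + 1 - reg \<sigma> ''h'') + 1 \<or>
      reg \<sigma> ''f'' = 1 \<and> n = 0 \<and> E = {(x, w) \<in> parcs G. x \<in> set Q}))"

lemma visit_step:
  assumes ok: "act_ok act I" and inv: "traverse_inv I n \<sigma>" and f: "reg \<sigma> ''f'' = 0"
  shows "\<exists>n'<n. traverse_inv I n' (run (visit act) \<sigma>)"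
proof -
  obtain Q E where *: "loaded \<sigma>" "I Q E (arr \<sigma>)" "queue \<sigma> Q" "position Q E \<sigma>"
      "n = (card (parcs G) - card E) + (card (parcs G) + 1 - reg \<sigma> ''h'') + 1"
    using inv f unfolding traverse_inv_def by auto
  have Q: "distinct Q" "set Q \<subseteq> reach G s"
    using ok *(2) by (auto simp: act_ok_def)
  have E: "E \<subseteq> {(x, w) \<in> parcs G. x \<in> set Q}"
    using position_arcs[OF *(4) Q(2)] .
  then have finE: "finite E"
    by (auto intro: finite_subset[OF _ pair_finite_arcs])
  \<comment> \<open>Keeps the subtraction of \<open>h\<close> in the variant from being truncated,
    so that taking a vertex really lowers it.\<close>
  have "length Q \<le> card (parcs G) + 1"
    using card_mono[OF finite_subset[OF reach_subset pair_finite_verts] Q(2)]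
      card_reach_le[OF pair_finite_arcs, of s] distinct_card[OF Q(1)] by linarith
  consider (arc) "reg \<sigma> ''j'' < reg \<sigma> ''e''"
    | (pop) "\<not> reg \<sigma> ''j'' < reg \<sigma> ''e''" "reg \<sigma> ''h'' < reg \<sigma> ''t''"
    | (stop) "\<not> reg \<sigma> ''j'' < reg \<sigma> ''e''" "\<not> reg \<sigma> ''h'' < reg \<sigma> ''t''"
    by blast
  then show ?thesis
  proof cases
    case arc
    define \<sigma>1 where "\<sigma>1 = run (Load ''w'' ''adj'' ''j'' ;; Inc ''j'') \<sigma>"
    define x w where "x = reg \<sigma>1 ''x''" and "w = reg \<sigma>1 ''w''"
    have run: "run (visit act) \<sigma> = run act \<sigma>1"
      using arc by (simp add: visit_def \<sigma>1_def)
    have adv: "x \<in> set Q" "(x, w) \<in> parcs G - E" "position Q (insert (x, w) E) \<sigma>1"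
      using position_advance[OF *(4) arc *(1) Q \<sigma>1_def] by (auto simp: x_def w_def)
    have \<sigma>1: "arr \<sigma>1 = arr \<sigma>" "loaded \<sigma>1" "queue \<sigma>1 Q" "reg \<sigma>1 ''f'' = 0" "reg \<sigma>1 ''h'' = reg \<sigma> ''h''"
      using *(1,3) f by (auto simp: \<sigma>1_def loaded_def queue_def)
    define \<sigma>2 where "\<sigma>2 = run act \<sigma>1"
    obtain Q' where Q': "loaded \<sigma>2" "\<forall>z\<in>{''h'', ''j'', ''e'', ''f'', ''x''}. reg \<sigma>2 z = reg \<sigma>1 z"
        "I (Q @ Q') (insert (x, w) E) (arr \<sigma>2)" "queue \<sigma>2 (Q @ Q')"
    proof -
      have "I Q E (arr \<sigma>1)"
        using \<sigma>1(1) *(2) by simp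
      note * = ok[unfolded act_ok_def, THEN conjunct2, THEN conjunct2, rule_format,
          OF this \<sigma>1(2,3) x_def[symmetric] w_def[symmetric] adv(1,2) E]
      show ?thesis
        using * that unfolding \<sigma>2_def by blast
    qed
    have "position (Q @ Q') (insert (x, w) E) \<sigma>2"
      using position_mono[OF adv(3), of Q'] Q'(2) by (simp add: position_def)
    moreover have "card (insert (x, w) E) = Suc (card E)"
      using adv(2) finE by simp
    \<comment> \<open>Likewise the number of unhandled arcs was positive and drops by exactly
      one.\<close>
    moreover have "card (insert (x, w) E) \<le> card (parcs G)"
      using adv(2) E pair_finite_arcs by (intro card_mono) auto
    ultimately show ?thesis
      using Q' \<sigma>1 *(5)
      unfolding run \<sigma>2_def[symmetric] traverse_inv_def
      by (intro exI[of _ "n - 1"] conjI exI[of _ "Q @ Q'"] exI[of _ "insert (x, w) E"]) auto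
  next
    case pop
    then have h: "reg \<sigma> ''h'' < length Q"
      using *(3) by (simp add: queue_def)
    define \<sigma>1 where "\<sigma>1 = run (Load ''x'' ''q'' ''h'' ;; Inc ''h'' ;; Load ''j'' ''off'' ''x'' ;;
         Copy ''y'' ''x'' ;; Inc ''y'' ;; Load ''e'' ''off'' ''y'') \<sigma>"
    have run: "run (visit act) \<sigma> = \<sigma>1"
      using pop by (simp add: visit_def \<sigma>1_def)
    have "position Q E \<sigma>1"
      using position_next[OF *(4) pop(1) h *(1,3) Q(2) \<sigma>1_def] .
    moreover have "loaded \<sigma>1" "queue \<sigma>1 Q" "arr \<sigma>1 = arr \<sigma>" "reg \<sigma>1 ''f'' = 0"
        "reg \<sigma>1 ''h'' = Suc (reg \<sigma> ''h'')"
      using *(1,3) f by (auto simp: \<sigma>1_def loaded_def queue_def)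
    ultimately show ?thesis
      using *(2,5) h \<open>length Q \<le> _\<close> unfolding run traverse_inv_def
      by (intro exI[of _ "n - 1"] conjI exI[of _ Q] exI[of _ E]) auto
  next
    case stop
    define \<sigma>1 where "\<sigma>1 = set_reg ''f'' 1 \<sigma>"
    have run: "run (visit act) \<sigma> = \<sigma>1"
      using stop by (simp add: visit_def \<sigma>1_def)
    have "reg \<sigma> ''h'' = length Q"
      using position_pop(1)[OF *(4) stop(1)] stop(2) *(3) by (simp add: queue_def)
    then have "E = {(y, z). y \<in> set Q \<and> z \<in> set (A ! y)}"
      using position_pop(2)[OF *(4) stop(1)] by simp
    also have "\<dots> = {(x, w) \<in> parcs G. x \<in> set Q}"
      using Q(2) reach_subset arc_iff by blast
    finally have "E = {(x, w) \<in> parcs G. x \<in> set Q}" .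
    moreover have "position Q E \<sigma>1" "loaded \<sigma>1" "queue \<sigma>1 Q" "arr \<sigma>1 = arr \<sigma>" "reg \<sigma>1 ''f'' = 1"
      using *(1,3,4) by (auto simp: \<sigma>1_def loaded_def queue_def position_def)
    ultimately show ?thesis
      using *(2,5) unfolding run traverse_inv_def
      by (intro exI[of _ 0] conjI exI[of _ Q] exI[of _ E]) auto
  qed
qed

text \<open>The invariant is required at the start for every content \<open>f\<close> of
  \<open>q\<close>, because only \<open>q[0]\<close> is set and the other cells may be left over
  from an earlier traversal.\<close>

lemma traverse_halts:
  assumes ok: "act_ok act I" and init: "\<And>f. I [s] {} ((arr \<sigma>)(''q'' := f))" and "loaded \<sigma>"
  shows "halts_within (traverse act) \<sigma> ((2 * steps (visit act) + 9) * (card (parcs G) + 1))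
    (\<lambda>\<sigma>'. loaded \<sigma>' \<and> (\<exists>Q. I Q {(x, w) \<in> parcs G. x \<in> set Q} (arr \<sigma>') \<and> queue \<sigma>' Q))"
proof -
  let ?m = "card (parcs G)"
  let ?b = "steps (visit act) + 1"
  have straight: "straight (visit act)"
    using ok by (simp add: act_ok_def visit_def)
  have "arr (run traverse_init \<sigma>) = (arr \<sigma>)(''q'' := (arr \<sigma> ''q'')(0 := s))"
    using assms(3) by (simp add: traverse_init_def loaded_def)
  then have "I [s] {} (arr (run traverse_init \<sigma>))"
    using init by metis
  moreover have "loaded (run traverse_init \<sigma>)" "queue (run traverse_init \<sigma>) [s]"
      "position [s] {} (run traverse_init \<sigma>)" "reg (run traverse_init \<sigma>) ''f'' = 0"
      "reg (run traverse_init \<sigma>) ''h'' = 0"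
    using assms(3) by (simp_all add: traverse_init_def loaded_def queue_def position_def)
  \<comment> \<open>With no arc handled and \<open>h = 0\<close> the variant is m + (m + 1) + 1,
    where m is the number of arcs.\<close>
  ultimately have inv0: "traverse_inv I (2 * (?m + 1)) (run traverse_init \<sigma>)"
    unfolding traverse_inv_def by (intro conjI exI[of _ "[s]"] exI[of _ "{}"]) auto
  have "halts_within (traverse act) \<sigma> (6 + (2 * (?m + 1) * ?b + 1))
     (\<lambda>\<sigma>'. \<not> holds (Equal ''f'' ''zero'') \<sigma>' \<and> (\<exists>n. traverse_inv I n \<sigma>'))"
    unfolding traverse_def
  proof (rule halts_Seq[where R = "traverse_inv I (2 * (?m + 1))"], goal_cases)
    case 1
    show ?case
      by (rule halts_straight) (use inv0 in \<open>auto simp: traverse_init_def\<close>)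
  next
    case (2 \<sigma>')
    show "halts_within (While (Equal ''f'' ''zero'') (visit act)) \<sigma>' (2 * (?m + 1) * ?b + 1)
        (\<lambda>\<sigma>'. \<not> holds (Equal ''f'' ''zero'') \<sigma>' \<and> (\<exists>n. traverse_inv I n \<sigma>'))"
    proof (rule halts_While[where I = "traverse_inv I", OF straight 2])
      show "\<exists>n'<n. traverse_inv I n' (run (visit act) \<sigma>)"
        if "traverse_inv I n \<sigma>" "holds (Equal ''f'' ''zero'') \<sigma>" for n \<sigma>
        by (rule visit_step[OF ok that(1)]) (use that in \<open>auto simp: traverse_inv_def loaded_def\<close>)
    qed
  qed
  then show ?thesis
  proof (rule halts_mono)
    show "6 + (2 * (?m + 1) * ?b + 1) \<le> (2 * steps (visit act) + 9) * (?m + 1)"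
      by (simp add: algebra_simps)
    show "loaded \<sigma>' \<and> (\<exists>Q. I Q {(x, w) \<in> parcs G. x \<in> set Q} (arr \<sigma>') \<and> queue \<sigma>' Q)"
      if "\<not> holds (Equal ''f'' ''zero'') \<sigma>' \<and> (\<exists>n. traverse_inv I n \<sigma>')" for \<sigma>'
      using that by (auto simp: traverse_inv_def loaded_def)
  qed
qed

end


section \<open>Labelling in topological order\<close>

text \<open>
  The array \<open>lab\<close> holds the successor of the label; \<open>0\<close> marks a vertex that has not been reached. The
  entry for \<open>w\<close> depends on the set \<open>X\<close> of entries offered by the predecessors of \<open>w\<close>.
\<close>

definition combine :: "nat \<Rightarrow> nat set \<Rightarrow> nat" where
  "combine w X = (if X = {} then 0 else if \<exists>c. X = {c} then the_elem X else Suc w)"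

text \<open>The stored entry tells enough about the offers to merge them one at a time: 0 for none,
  the common offer if they agree, \<open>Suc w\<close> once they differ. After a disagreement it
  stays \<open>Suc w\<close>, even if a later offer equals \<open>Suc w\<close>. The premise keeps 0
  free as the mark for no offer.\<close>

lemma combine_insert:
  assumes "0 \<notin> X"
  shows "combine w (insert c X) = (if combine w X = 0 \<or> combine w X = c then c else Suc w)"
proof -
  consider "X = {}" | d where "X = {d}" "d \<noteq> 0" | "X \<noteq> {}" "\<nexists>d. X = {d}"
    using assms by (metis singletonI)
  then show ?thesis
  proof cases
    case 3
    then have "\<nexists>d. insert c X = {d}"
      by (metis subset_insertI subset_singletonD)
    with 3 show ?thesis
      by (simp add: combine_def)
  qed (auto simp: combine_def doubleton_eq_iff)
qed

text \<open>Only arcs from reachable vertices are counted, since any other arc would never be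
  released in the second traversal. A zero counter also marks an undiscovered vertex.\<close>

definition count_act :: com where
  "count_act = Load ''c'' ''cnt'' ''w'' ;;
     Cond (Equal ''c'' ''zero'') (Store ''q'' ''t'' ''w'' ;; Inc ''t'') Skip ;;
     Inc ''c'' ;; Store ''cnt'' ''w'' ''c''"

text \<open>Carries out \<open>combine_insert\<close>: \<open>r\<close> is first the offer of
  \<open>x\<close> and then the new entry of \<open>w\<close>.\<close>

definition merge_act :: com where
  "merge_act = Load ''r'' ''lab'' ''x'' ;;
     Cond (Equal ''x'' ''s'') (Copy ''r'' ''w'' ;; Inc ''r'') Skip ;;
     Load ''l'' ''lab'' ''w'' ;;
     Cond (Equal ''l'' ''zero'') Skip
       (Cond (Equal ''l'' ''r'') Skip (Copy ''r'' ''w'' ;; Inc ''r'')) ;;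
     Store ''lab'' ''w'' ''r''"

text \<open>Topological sorting by removal of arcs: a vertex enters the queue with the last of its
  counted incoming arcs.\<close>

definition release_act :: com where
  "release_act = Load ''c'' ''cnt'' ''w'' ;; Dec ''c'' ;; Store ''cnt'' ''w'' ''c'' ;;
     Cond (Equal ''c'' ''zero'') (Store ''q'' ''t'' ''w'' ;; Inc ''t'') Skip"

lemma run_merge:
  assumes "reg \<sigma> ''zero'' = 0" "reg \<sigma> ''x'' = x" "reg \<sigma> ''w'' = w"
    "c = (if x = reg \<sigma> ''s'' then Suc w else arr \<sigma> ''lab'' x)"
  shows "arr (run merge_act \<sigma>) = (arr \<sigma>)(''lab'' := (arr \<sigma> ''lab'')
      (w := if arr \<sigma> ''lab'' w = 0 \<or> arr \<sigma> ''lab'' w = c then c else Suc w))"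
    "out (run merge_act \<sigma>) = out \<sigma>"
    "z \<notin> {''r'', ''l''} \<Longrightarrow> reg (run merge_act \<sigma>) z = reg \<sigma> z"
  using assms
  by (cases "x = reg \<sigma> ''s''"; cases "arr \<sigma> ''lab'' w = 0"; cases "arr \<sigma> ''lab'' w = c";
      simp add: merge_act_def)+

lemma run_release:
  assumes "reg \<sigma> ''zero'' = 0" "reg \<sigma> ''w'' = w" "n = arr \<sigma> ''cnt'' w - 1"
  shows "arr (run release_act \<sigma>) ''cnt'' = (arr \<sigma> ''cnt'')(w := n)"
    "arr (run release_act \<sigma>) ''q'' = (if n = 0 then (arr \<sigma> ''q'')(reg \<sigma> ''t'' := w) else arr \<sigma> ''q'')"
    "z \<notin> {''cnt'', ''q''} \<Longrightarrow> arr (run release_act \<sigma>) z = arr \<sigma> z"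
    "out (run release_act \<sigma>) = out \<sigma>"
    "reg (run release_act \<sigma>) ''t'' = (if n = 0 then Suc (reg \<sigma> ''t'') else reg \<sigma> ''t'')"
    "z \<notin> {''c'', ''t''} \<Longrightarrow> reg (run release_act \<sigma>) z = reg \<sigma> z"
  using assms by (cases "n = 0"; simp add: release_act_def)+

lemma run_count:
  assumes "reg \<sigma> ''zero'' = 0" "reg \<sigma> ''w'' = w" "n = arr \<sigma> ''cnt'' w"
  shows "arr (run count_act \<sigma>) ''cnt'' = (arr \<sigma> ''cnt'')(w := Suc n)"
    "arr (run count_act \<sigma>) ''q'' = (if n = 0 then (arr \<sigma> ''q'')(reg \<sigma> ''t'' := w) else arr \<sigma> ''q'')"
    "z \<notin> {''cnt'', ''q''} \<Longrightarrow> arr (run count_act \<sigma>) z = arr \<sigma> z"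
    "out (run count_act \<sigma>) = out \<sigma>"
    "reg (run count_act \<sigma>) ''t'' = (if n = 0 then Suc (reg \<sigma> ''t'') else reg \<sigma> ''t'')"
    "z \<notin> {''c'', ''t''} \<Longrightarrow> reg (run count_act \<sigma>) z = reg \<sigma> z"
  using assms by (cases "n = 0"; simp add: count_act_def)+

definition label_act :: com where
  "label_act = merge_act ;; release_act"

context rooted_dag
begin

lemma queue_push:
  assumes "queue \<sigma> Q" "reg \<sigma>' ''t'' = (if b then Suc (reg \<sigma> ''t'') else reg \<sigma> ''t'')"
    "arr \<sigma>' ''q'' = (if b then (arr \<sigma> ''q'')(reg \<sigma> ''t'' := w) else arr \<sigma> ''q'')"
  shows "queue \<sigma>' (Q @ (if b then [w] else []))"
  using assms by (auto simp: queue_def nth_append less_Suc_eq)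

section \<open>First traversal: discovery and in-degrees\<close>

definition count_inv :: "nat list \<Rightarrow> (nat \<times> nat) set \<Rightarrow> (vname \<Rightarrow> nat \<Rightarrow> nat) \<Rightarrow> bool" where
  "count_inv Q E a \<longleftrightarrow> distinct Q \<and> set Q \<subseteq> reach G s \<and> set Q = insert s (snd ` E) \<and>
     (\<forall>w. a ''cnt'' w = card {p. (p, w) \<in> E}) \<and> a ''lab'' = (\<lambda>_. 0)"

lemma finite_tails: "E \<subseteq> parcs G \<Longrightarrow> finite {p. (p, w) \<in> E}"
  by (rule finite_subset[of _ "fst ` parcs G"]) (auto simp: pair_finite_arcs image_iff, force)

lemma count_ok: "act_ok count_act count_inv"
  unfolding act_ok_def
proof (intro conjI allI impI)
  show "straight count_act" by (simp add: count_act_def)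
  show "distinct Q" "set Q \<subseteq> reach G s" if "count_inv Q E a" for Q E a
    using that by (auto simp: count_inv_def)
  fix Q E \<sigma> x w
  assume I: "count_inv Q E (arr \<sigma>)" and l: "loaded \<sigma>" and q: "queue \<sigma> Q"
    and x: "reg \<sigma> ''x'' = x" and w: "reg \<sigma> ''w'' = w" and xQ: "x \<in> set Q"
    and xw: "(x, w) \<in> parcs G - E" and E: "E \<subseteq> {(x, w) \<in> parcs G. x \<in> set Q}"
  let ?\<sigma> = "run count_act \<sigma>"
  note zw = conjunct1[OF conjunct2[OF conjunct2[OF conjunct2[OF l[unfolded loaded_def]]]]] w
  note count = run_count[OF zw refl]
  show "loaded ?\<sigma>"
    using l by (simp add: loaded_def count)
  show "\<forall>z\<in>{''h'', ''j'', ''e'', ''f'', ''x''}. reg ?\<sigma> z = reg \<sigma> z"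
    by (simp add: count)
  have "x \<in> reach G s"
    using I xQ by (auto simp: count_inv_def)
  then have w': "w \<noteq> s" "w \<in> reach G s"
    using no_arc_to_root reach_step xw by auto
  have EG: "E \<subseteq> parcs G" using E by auto
  have fin: "finite {p. (p, v) \<in> E}" for v
    using finite_tails[OF EG] .
  define Q' where "Q' = (if arr \<sigma> ''cnt'' w = 0 then [w] else [])"
  \<comment> \<open>A positive counter means that a handled arc enters \<open>w\<close>, hence that
    \<open>w\<close> is queued. The only other queued vertex is \<open>s\<close>, and
    \<open>w ~= s\<close>.\<close>
  have new: "arr \<sigma> ''cnt'' w = 0 \<longleftrightarrow> w \<notin> set Q"
    using I w'(1) fin by (auto simp: count_inv_def image_iff)
  have tails: "{p. (p, v) \<in> insert (x, w) E} = (if v = w then insert x {p. (p, w) \<in> E} else {p. (p, v) \<in> E})" for v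
    by auto
  have cnt: "arr ?\<sigma> ''cnt'' = (arr \<sigma> ''cnt'')(w := Suc (arr \<sigma> ''cnt'' w))" "arr ?\<sigma> ''lab'' = arr \<sigma> ''lab''"
    by (simp_all add: count)
  have card': "arr ?\<sigma> ''cnt'' v = card {p. (p, v) \<in> insert (x, w) E}" for v
    unfolding tails cnt using I xw fin[of w] by (simp add: count_inv_def)
  have "count_inv (Q @ Q') (insert (x, w) E) (arr ?\<sigma>)"
    using I new w'(2) card' unfolding count_inv_def Q'_def by (auto simp: cnt(2))
  moreover have "queue ?\<sigma> (Q @ Q')"
    unfolding Q'_def using queue_push[OF q count(5,2)] .
  ultimately show "\<exists>Q'. count_inv (Q @ Q') (insert (x, w) E) (arr ?\<sigma>) \<and> queue ?\<sigma> (Q @ Q')"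
    by (intro exI conjI)
qed

text \<open>Once all arcs out of the queue are handled, the queue is closed under arcs and contains
  \<open>s\<close>, so it is the whole of \<open>reach G s\<close>.\<close>

lemma count_final:
  assumes "count_inv Q {(x, w) \<in> parcs G. x \<in> set Q} a"
  shows "a ''cnt'' w = card {p \<in> reach G s. (p, w) \<in> parcs G}" "a ''lab'' = (\<lambda>_. 0)"
proof -
  have Q: "set Q \<subseteq> reach G s" "set Q = insert s (snd ` {(x, w) \<in> parcs G. x \<in> set Q})"
    using assms by (auto simp: count_inv_def)
  have step: "w \<in> set Q" if "x \<in> set Q" "(x, w) \<in> parcs G" for x w
    using that by (subst Q(2)) (force simp: image_iff)
  have root: "s \<in> set Q"
    using Q(2) by blast
  have "v \<in> set Q" if "(s, v) \<in> (parcs G)\<^sup>*" for v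
    using that by induction (auto simp: root step)
  then have "set Q = reach G s"
    using Q(1) by (auto simp: reach_def)
  then show "a ''cnt'' w = card {p \<in> reach G s. (p, w) \<in> parcs G}"
    using assms by (simp add: count_inv_def conj_commute)
  show "a ''lab'' = (\<lambda>_. 0)"
    using assms by (simp add: count_inv_def)
qed

section \<open>Second traversal: topological order and labels\<close>

text \<open>An arc from \<open>s\<close> offers its own head, which never agrees with the offer of another arc.\<close>

definition arrival :: "(nat \<Rightarrow> nat) \<Rightarrow> nat \<Rightarrow> nat \<Rightarrow> nat" where
  "arrival L w p = (if p = s then Suc w else L p)"

text \<open>The equation for \<open>lab\<close> refers to \<open>lab\<close> itself. This is sound
  because tails of handled arcs are queued, and entries of queued vertices no longer change, so
  offers once made stay valid. The last clause is the topological order of the queue.\<close>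

definition label_inv :: "nat list \<Rightarrow> (nat \<times> nat) set \<Rightarrow> (vname \<Rightarrow> nat \<Rightarrow> nat) \<Rightarrow> bool" where
  "label_inv Q E a \<longleftrightarrow> distinct Q \<and>
     set Q = {w \<in> reach G s. \<forall>p\<in>reach G s. (p, w) \<in> parcs G \<longrightarrow> (p, w) \<in> E} \<and>
     (\<forall>w. a ''cnt'' w = card {p \<in> reach G s. (p, w) \<in> parcs G - E}) \<and>
     a ''lab'' s = Suc s \<and>
     (\<forall>w. w \<noteq> s \<longrightarrow> a ''lab'' w = combine w (arrival (a ''lab'') w ` {p. (p, w) \<in> E})) \<and>
     (\<forall>w\<in>set Q. a ''lab'' w \<noteq> 0) \<and>
     (\<forall>i<length Q. \<forall>p\<in>reach G s. (p, Q ! i) \<in> parcs G \<longrightarrow> p \<in> set (take i Q))"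

lemma label_ok: "act_ok label_act label_inv"
  unfolding act_ok_def
proof (intro conjI allI impI)
  show "straight label_act" by (simp add: label_act_def merge_act_def release_act_def)
  show "distinct Q" "set Q \<subseteq> reach G s" if "label_inv Q E a" for Q E a
    using that by (auto simp: label_inv_def)
  fix Q E \<sigma> x w
  assume I: "label_inv Q E (arr \<sigma>)" and l: "loaded \<sigma>" and q: "queue \<sigma> Q"
    and x: "reg \<sigma> ''x'' = x" and w: "reg \<sigma> ''w'' = w" and xQ: "x \<in> set Q"
    and xw: "(x, w) \<in> parcs G - E" and E: "E \<subseteq> {(x, w) \<in> parcs G. x \<in> set Q}"
  let ?\<sigma> = "run label_act \<sigma>"
  have zero: "reg \<sigma> ''zero'' = 0" and s: "reg \<sigma> ''s'' = s"
    using l by (simp_all add: loaded_def)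
  have c: "arrival (arr \<sigma> ''lab'') w x = (if x = reg \<sigma> ''s'' then Suc w else arr \<sigma> ''lab'' x)"
    by (simp add: arrival_def s)
  note merge = run_merge[OF zero x w c]
  have "reg (run merge_act \<sigma>) ''zero'' = 0" "reg (run merge_act \<sigma>) ''w'' = w"
    using merge(3) zero w by simp_all
  note release = run_release[OF this refl, folded run.simps(9), folded label_act_def]
  show "loaded ?\<sigma>"
    using l by (simp add: loaded_def release merge)
  show "\<forall>z\<in>{''h'', ''j'', ''e'', ''f'', ''x''}. reg ?\<sigma> z = reg \<sigma> z"
    by (simp add: release merge)
  define L where "L = arr \<sigma> ''lab''"
  define C where "C = arr \<sigma> ''cnt''"
  have inv: "distinct Q"
      "set Q = {w \<in> reach G s. \<forall>p\<in>reach G s. (p, w) \<in> parcs G \<longrightarrow> (p, w) \<in> E}"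
      "\<And>w. C w = card {p \<in> reach G s. (p, w) \<in> parcs G - E}" "L s = Suc s"
      "\<And>w. w \<noteq> s \<Longrightarrow> L w = combine w (arrival L w ` {p. (p, w) \<in> E})" "\<And>w. w \<in> set Q \<Longrightarrow> L w \<noteq> 0"
      "\<And>i p. i < length Q \<Longrightarrow> p \<in> reach G s \<Longrightarrow> (p, Q ! i) \<in> parcs G \<Longrightarrow> p \<in> set (take i Q)"
    using I by (auto simp: label_inv_def L_def C_def)
  have x': "x \<in> reach G s"
    using inv(2) xQ by auto
  \<comment> \<open>The arc from \<open>x\<close> to \<open>w\<close> is not yet handled, whereas
    all arcs from reachable vertices into queued ones are; so \<open>w\<close> is still
    waiting.\<close>
  have w': "w \<noteq> s" "w \<in> reach G s" "w \<notin> set Q"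
    using no_arc_to_root[OF x'] reach_step[OF x'] xw inv(2) x' by auto
  define c where "c = arrival L w x"
  define b where "b = (if L w = 0 \<or> L w = c then c else Suc w)"
  define L' where "L' = L(w := b)"
  define C' where "C' = C(w := C w - 1)"
  define Q' where "Q' = (if C w - 1 = 0 then [w] else [])"
  have res: "arr ?\<sigma> ''lab'' = L'" "arr ?\<sigma> ''cnt'' = C'" "queue ?\<sigma> (Q @ Q')"
  proof -
    show "arr ?\<sigma> ''lab'' = L'" "arr ?\<sigma> ''cnt'' = C'"
      by (simp_all add: release merge L'_def C'_def b_def c_def L_def C_def)
    show "queue ?\<sigma> (Q @ Q')"
      unfolding Q'_def by (rule queue_push[OF q]) (simp_all add: release merge C_def)
  qed
  define E' where "E' = insert (x, w) E"
  have fin: "finite {p \<in> reach G s. (p, v) \<in> parcs G - E}" for v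
    by (rule finite_subset[OF _ finite_tails[of "parcs G" v]]) auto
  have todo: "{p \<in> reach G s. (p, v) \<in> parcs G - E'} =
      (if v = w then {p \<in> reach G s. (p, w) \<in> parcs G - E} - {x} else {p \<in> reach G s. (p, v) \<in> parcs G - E})" for v
    by (auto simp: E'_def)
  \<comment> \<open>\<open>x\<close> is among the tails still counted for \<open>w\<close>, so the
    decrement is not truncated.\<close>
  have C': "C' v = card {p \<in> reach G s. (p, v) \<in> parcs G - E'}" for v
    using fin inv(3) x' xw unfolding todo C'_def by (auto simp: card_Diff_singleton)
  have "set (Q @ Q') = {v \<in> reach G s. \<forall>p\<in>reach G s. (p, v) \<in> parcs G \<longrightarrow> (p, v) \<in> E'}"
  proof -
    have "C w - 1 = 0 \<longleftrightarrow> {p \<in> reach G s. (p, w) \<in> parcs G - E'} = {}"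
      using C'[of w] fin unfolding todo C'_def by (simp del: Diff_eq_empty_iff)
    then show ?thesis
      using w'(2) inv(2) xw x' by (auto simp: Q'_def E'_def)
  qed
  moreover have "c \<noteq> 0"
    using inv(6)[OF xQ] by (simp add: c_def arrival_def)
  then have "\<forall>v\<in>set (Q @ Q'). L' v \<noteq> 0"
    using inv(6) w'(3) by (auto simp: L'_def b_def Q'_def)
  moreover have "L' v = combine v (arrival L' v ` {p. (p, v) \<in> E'})" if "v \<noteq> s" for v
  proof -
    \<comment> \<open>Tails of handled arcs are queued and hence different from \<open>w\<close>, so
      the update at \<open>w\<close> alters no offer.\<close>
    have arr: "arrival L' v ` {p. (p, v) \<in> E} = arrival L v ` {p. (p, v) \<in> E}"
      using E w'(3) by (intro image_cong) (auto simp: arrival_def L'_def)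
    show ?thesis
    proof (cases "v = w")
      case True
      have "arrival L' w ` {p. (p, w) \<in> E'} = insert c (arrival L w ` {p. (p, w) \<in> E})"
        using arr True xQ w'(3) by (auto simp: E'_def c_def arrival_def L'_def)
      moreover have "0 \<notin> arrival L w ` {p. (p, w) \<in> E}"
        using E inv(6) by (fastforce simp: arrival_def split: if_splits)
      ultimately have "combine w (arrival L' w ` {p. (p, w) \<in> E'}) = b"
        using combine_insert inv(5)[OF w'(1)] by (simp add: b_def)
      then show ?thesis
        using True by (simp add: L'_def)
    next
      case False
      then have "{p. (p, v) \<in> E'} = {p. (p, v) \<in> E}"
        by (auto simp: E'_def)
      then show ?thesis
        using arr inv(5)[OF that] False by (simp add: L'_def)
    qed
  qed
  moreover have "p \<in> set (take i (Q @ Q'))"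
    if "i < length (Q @ Q')" "p \<in> reach G s" "(p, (Q @ Q') ! i) \<in> parcs G" for i p
  proof (cases "i < length Q")
    case True
    then show ?thesis using inv(7) that by (simp add: nth_append)
  next
    case False
    then have i: "i = length Q" "Q' = [w]"
      using that(1) by (auto simp: Q'_def split: if_splits)
    \<comment> \<open>As \<open>w\<close> has just been queued, each arc into it from a reachable
      vertex is handled, so its tail is in the old queue.\<close>
    then have "(p, w) \<in> E'"
      using calculation(1) that by auto
    then show ?thesis
      using E xQ i by (auto simp: E'_def)
  qed
  ultimately have "label_inv (Q @ Q') E' (arr ?\<sigma>)"
    using inv(1,4) w' C' unfolding label_inv_def res
    by (simp add: L'_def Q'_def)
  then show "\<exists>Q'. label_inv (Q @ Q') (insert (x, w) E) (arr ?\<sigma>) \<and> queue ?\<sigma> (Q @ Q')"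
    using res(3) unfolding E'_def by (intro exI conjI)
qed

lemma label_final:
  assumes "label_inv Q {(x, w) \<in> parcs G. x \<in> set Q} a"
  shows "set Q = reach G s" "\<And>v. v \<in> reach G s \<longleftrightarrow> a ''lab'' v \<noteq> 0"
    "branch_labelling G s (\<lambda>v. a ''lab'' v - 1)"
proof -
  let ?L = "a ''lab''"
  have inv: "set Q = {w \<in> reach G s. \<forall>p\<in>reach G s. (p, w) \<in> parcs G \<longrightarrow> p \<in> set Q}" "?L s = Suc s"
      "\<And>w. w \<noteq> s \<Longrightarrow> ?L w = combine w (arrival ?L w ` {p. (p, w) \<in> parcs G \<and> p \<in> set Q})"
      "\<And>w. w \<in> set Q \<Longrightarrow> ?L w \<noteq> 0"
    using assms by (auto simp: label_inv_def)
  \<comment> \<open>Induction along the arcs: a reachable vertex whose reachable predecessors are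
    all queued is queued too. Acyclicity thus excludes a deadlock.\<close>
  have "v \<in> reach G s \<longrightarrow> v \<in> set Q" for v
    by (induction v rule: wf_induct_rule[OF wf_arcs]) (subst inv(1), blast)
  then show Q: "set Q = reach G s"
    using inv(1) by blast
  have outside: "?L v = 0" if "v \<notin> reach G s" for v
  proof -
    have "{p. (p, v) \<in> parcs G \<and> p \<in> set Q} = {}"
      using that Q by (auto dest: reach_step)
    moreover have "v \<noteq> s" using that by auto
    ultimately show ?thesis
      using inv(3) by (simp add: combine_def)
  qed
  then show "v \<in> reach G s \<longleftrightarrow> ?L v \<noteq> 0" for v
    using inv(4) Q by auto
  show "branch_labelling G s (\<lambda>v. ?L v - 1)"
    unfolding branch_labelling_def
  proof (intro conjI ballI allI impI)
    show "?L s - 1 = s" using inv(2) by simp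
    fix v assume v: "v \<in> reach G s - {s}"
    define X where "X = arrival ?L v ` {p. (p, v) \<in> parcs G \<and> p \<in> set Q}"
    have L: "?L v = combine v X"
      using inv(3) v by (auto simp: X_def)
    obtain p0 where p0: "p0 \<in> reach G s" "(p0, v) \<in> parcs G"
      using v by (auto elim: reach_pred)
    show "?L v - 1 = v \<or> (\<forall>p\<in>reach G s. (p, v) \<in> parcs G \<longrightarrow> p \<noteq> s \<and> ?L p - 1 = ?L v - 1)"
    proof (cases "?L v = Suc v")
      \<comment> \<open>The offers agree, since otherwise the entry would be \<open>Suc v\<close>.
        None comes from \<open>s\<close>, whose offer would be \<open>Suc v\<close> as well.\<close>
      case False
      moreover have "X \<noteq> {}" using p0 Q by (auto simp: X_def)
      ultimately have "X = {?L v}"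
        using L by (auto simp: combine_def split: if_splits)
      then have "arrival ?L v p = ?L v" if "p \<in> reach G s" "(p, v) \<in> parcs G" for p
        using that Q by (auto simp: X_def)
      then show ?thesis
        using False by (metis arrival_def)
    qed simp
    show "?L v - 1 = c" if "c \<noteq> s" "\<forall>p\<in>reach G s. (p, v) \<in> parcs G \<longrightarrow> ?L p - 1 = c" for c
    proof -
      have "arrival ?L v p = Suc c" if p: "p \<in> reach G s" "(p, v) \<in> parcs G" for p
      proof -
        \<comment> \<open>\<open>p = s\<close> would give \<open>c = s\<close>. Entries of reached
          vertices are positive, so the decrement loses no information.\<close>
        have "p \<noteq> s" using \<open>c \<noteq> s\<close> \<open>\<forall>p\<in>_. _\<close> p inv(2) by force
        moreover have "?L p - 1 = c" using \<open>\<forall>p\<in>_. _\<close> p by blast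
        moreover have "?L p \<noteq> 0" using inv(4) p(1) Q by blast
        ultimately show ?thesis by (simp add: arrival_def)
      qed
      then have "X = {Suc c}"
        using p0 Q by (auto simp: X_def)
      then show ?thesis using L by (simp add: combine_def)
    qed
  qed
qed

end


section \<open>A circular list with contiguous blocks\<close>

text \<open>The last entry points to \<open>e\<close>; the circular list is the case where
  \<open>e\<close> is its first element.\<close>

fun linked :: "('a \<Rightarrow> 'a) \<Rightarrow> 'a list \<Rightarrow> 'a \<Rightarrow> bool" where
  "linked nx [] e \<longleftrightarrow> True"
| "linked nx (x # xs) e \<longleftrightarrow> nx x = hd (xs @ [e]) \<and> linked nx xs e"

lemma linked_append: "linked nx (xs @ y # ys) e \<longleftrightarrow> linked nx xs y \<and> linked nx (y # ys) e"
  by (induction xs) (auto simp: hd_append)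

lemma linked_upd: "u \<notin> set xs \<Longrightarrow> linked (nx(u := v)) xs e \<longleftrightarrow> linked nx xs e"
  by (induction xs) auto

lemma linked_insert:
  assumes "linked nx (xs @ u # ys) e" "distinct (xs @ u # ys)" "v \<notin> set (xs @ u # ys)"
  shows "linked (nx(v := nx u, u := v)) (xs @ u # v # ys) e"
  using assms by (auto simp: linked_append linked_upd)

lemma linked_nth: "linked nx xs e \<Longrightarrow> i < length xs \<Longrightarrow> nx (xs ! i) = (xs @ [e]) ! Suc i"
  by (induction xs arbitrary: i) (auto simp: less_Suc_eq_0_disj hd_conv_nth nth_append)

definition grouped :: "('a \<Rightarrow> 'a) \<Rightarrow> 'a list \<Rightarrow> bool" where
  "grouped r xs \<longleftrightarrow> (\<exists>bs. xs = concat bs \<and> (\<forall>b\<in>set bs. b \<noteq> [] \<and> (\<forall>x\<in>set b. r x = hd b)))"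

lemma grouped_Nil: "grouped r []"
  unfolding grouped_def by (intro exI[of _ "[]"]) simp

lemma grouped_Cons: "grouped r xs \<Longrightarrow> r v = v \<Longrightarrow> grouped r (v # xs)"
  unfolding grouped_def by (elim exE, rule_tac x = "[v] # bs" in exI) auto

text \<open>A vertex that is its own label heads its block, so the place right behind it is still
  inside the block.\<close>

lemma grouped_insert:
  assumes "grouped r xs" "u \<in> set xs" "r u = u" "r v = u"
  obtains ys zs where "xs = ys @ u # zs" "grouped r (ys @ u # v # zs)"
proof -
  obtain bs where bs: "xs = concat bs" "\<forall>b\<in>set bs. b \<noteq> [] \<and> (\<forall>x\<in>set b. r x = hd b)"
    using assms(1) by (auto simp: grouped_def)
  then obtain b where b: "b \<in> set bs" "u \<in> set b"
    using assms(2) by auto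
  then have "hd b = u" "b \<noteq> []"
    using bs(2) assms(3) by force+
  then have tl: "b = u # tl b"
    by (metis list.collapse)
  obtain as cs where as: "bs = as @ b # cs"
    using b(1) by (meson split_list)
  have "xs = concat as @ u # (tl b @ concat cs)"
    using bs(1) as tl by (metis append_Cons concat.simps(2) concat_append)
  moreover have "\<forall>c\<in>set (as @ (u # v # tl b) # cs). c \<noteq> [] \<and> (\<forall>x\<in>set c. r x = hd c)"
    using bs(2) as tl assms(3,4) \<open>hd b = u\<close> by (auto dest: list.set_sel(2))
  then have "grouped r (concat as @ u # v # (tl b @ concat cs))"
    unfolding grouped_def by (intro exI[of _ "as @ (u # v # tl b) # cs"]) simp
  ultimately show thesis
    by (rule that)
qed

text \<open>Take for \<open>p\<close> the position where the block of \<open>xs ! i\<close> begins;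
  contiguity puts all positions from \<open>p\<close> to \<open>i\<close> into this block.\<close>

lemma grouped_nth:
  assumes "grouped r xs" "distinct xs" "i < length xs"
  obtains p where "p \<le> i" "xs ! p = r (xs ! i)" "\<And>j. p \<le> j \<Longrightarrow> j \<le> i \<Longrightarrow> r (xs ! j) = r (xs ! i)"
proof -
  obtain bs where bs: "xs = concat bs" "\<forall>b\<in>set bs. b \<noteq> [] \<and> (\<forall>x\<in>set b. r x = hd b)"
    using assms(1) by (auto simp: grouped_def)
  then obtain b where b: "b \<in> set bs" "xs ! i \<in> set b"
    using nth_mem[OF assms(3)] by auto
  obtain as cs where as: "bs = as @ b # cs"
    using b(1) by (meson split_list)
  obtain k where k: "k < length b" "b ! k = xs ! i"
    using b(2) by (meson in_set_conv_nth)
  have xs: "xs = concat as @ b @ concat cs"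
    using bs(1) as by simp
  have at: "xs ! (length (concat as) + j) = b ! j" if "j < length b" for j
    using that by (simp add: xs nth_append)
  \<comment> \<open>Without repetitions, the occurrence found inside the block is the one at
    position \<open>i\<close>.\<close>
  have i: "i = length (concat as) + k"
    using at[OF k(1)] k assms(2,3) by (subst nth_eq_iff_index_eq[symmetric, OF assms(2)]) (auto simp: xs)
  show thesis
  proof (rule that)
    show "length (concat as) \<le> i" using i by simp
    have "r (xs ! i) = hd b" using b bs(2) by auto
    moreover have "hd b = b ! 0" using b(1) bs(2) by (simp add: hd_conv_nth)
    ultimately show "xs ! length (concat as) = r (xs ! i)"
      using at[of 0] k(1) by (cases b) auto
    fix j assume j: "length (concat as) \<le> j" "j \<le> i"
    then obtain l where l: "j = length (concat as) + l" "l < length b"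
      using i k(1) by (metis add_le_cancel_left le_Suc_ex le_less_trans)
    then have "xs ! j \<in> set b" using at by simp
    then show "r (xs ! j) = r (xs ! i)" using b bs(2) by auto
  qed
qed

text \<open>
  A vertex is inserted immediately behind its representative, and a new representative immediately
  behind \<open>s\<close>, so that blocks remain contiguous.
\<close>

definition chain_body :: com where
  "chain_body = Load ''v'' ''q'' ''i'' ;; Load ''r'' ''lab'' ''v'' ;; Dec ''r'' ;;
     Cond (Equal ''r'' ''v'') (Copy ''r'' ''s'') Skip ;;
     Load ''y'' ''nxt'' ''r'' ;; Store ''nxt'' ''v'' ''y'' ;; Store ''nxt'' ''r'' ''v'' ;; Inc ''i''"

definition chain :: com where
  "chain = (Store ''nxt'' ''s'' ''s'' ;; Const ''i'' 1) ;; While (Less ''i'' ''t'') chain_body"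

lemma run_chain_body:
  assumes "v = arr \<sigma> ''q'' (reg \<sigma> ''i'')" "l = arr \<sigma> ''lab'' v - 1"
    "u = (if l = v then reg \<sigma> ''s'' else l)"
  shows "arr (run chain_body \<sigma>) =
      (arr \<sigma>)(''nxt'' := (arr \<sigma> ''nxt'')(v := arr \<sigma> ''nxt'' u, u := v))"
    "out (run chain_body \<sigma>) = out \<sigma>"
    "reg (run chain_body \<sigma>) ''i'' = Suc (reg \<sigma> ''i'')"
    "z \<notin> {''v'', ''r'', ''y'', ''i''} \<Longrightarrow> reg (run chain_body \<sigma>) z = reg \<sigma> z"
  using assms by (cases "l = v"; simp add: chain_body_def)+

section \<open>Construction of the circular list from the queue\<close>

context rooted_dag
begin

text \<open>A vertex that is not its own label inherits from a predecessor, which stands earlier in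
  the queue. Hence its representative is already in the circular list when the vertex is
  inserted.\<close>

lemma label_order:
  assumes lab: "branch_labelling G s r" and Q: "set Q = reach G s"
    and order: "\<And>i p. i < length Q \<Longrightarrow> p \<in> reach G s \<Longrightarrow> (p, Q ! i) \<in> parcs G \<Longrightarrow> p \<in> set (take i Q)"
    and i: "i < length Q" "Q ! i \<noteq> s"
  shows "r (Q ! i) \<noteq> s \<and> r (r (Q ! i)) = r (Q ! i) \<and> (r (Q ! i) = Q ! i \<or> r (Q ! i) \<in> set (take i Q))"
  using i
proof (induction i rule: less_induct)
  case (less i)
  let ?v = "Q ! i"
  have v: "?v \<in> reach G s"
    using less.prems Q by (metis nth_mem)
  show ?case
  proof (cases "r ?v = ?v")
    case True
    then show ?thesis using less.prems by simp
  next
    case False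
    obtain p where p: "p \<in> reach G s" "(p, ?v) \<in> parcs G"
      using v less.prems(2) by (metis reach_pred)
    then have "p \<noteq> s" "r p = r ?v"
      using lab v less.prems(2) False unfolding branch_labelling_def by auto
    obtain j where j: "j < i" "j < length Q" "p = Q ! j"
      using order[OF less.prems(1) p] by (auto simp: in_set_conv_nth)
    have "set (take j Q) \<subseteq> set (take i Q)" "Q ! j \<in> set (take i Q)"
      using j less.prems(1) by (auto simp: set_take_subset_set_take in_set_conv_nth)
    then show ?thesis
      using less.IH[OF j(1,2)] j(3) \<open>p \<noteq> s\<close> \<open>r p = r ?v\<close> by auto
  qed
qed

text \<open>Any other first vertex would have a reachable predecessor standing before it.\<close>

lemma queue_hd:
  assumes Q: "set Q = reach G s"
    and order: "\<And>i p. i < length Q \<Longrightarrow> p \<in> reach G s \<Longrightarrow> (p, Q ! i) \<in> parcs G \<Longrightarrow> p \<in> set (take i Q)"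
  shows "Q \<noteq> []" "Q ! 0 = s"
proof -
  show ne: "Q \<noteq> []"
    using Q reach_self by (metis empty_iff list.set(1))
  show "Q ! 0 = s"
  proof (rule ccontr)
    assume "Q ! 0 \<noteq> s"
    moreover have "Q ! 0 \<in> reach G s"
      using ne Q by (metis length_greater_0_conv nth_mem)
    ultimately obtain p where "p \<in> reach G s" "(p, Q ! 0) \<in> parcs G"
      by (metis reach_pred)
    then show False
      using order[of 0 p] ne by simp
  qed
qed

text \<open>\<open>s\<close> is kept apart from the grouped list \<open>xs\<close>: a new block is
  opened right behind \<open>s\<close>, that is, at the front of \<open>xs\<close>.\<close>

definition chain_inv where
  "chain_inv Q L n \<sigma> \<longleftrightarrow> (\<exists>xs. loaded \<sigma> \<and> queue \<sigma> Q \<and> arr \<sigma> ''lab'' = L \<and>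
     0 < reg \<sigma> ''i'' \<and> reg \<sigma> ''i'' \<le> length Q \<and> n = length Q - reg \<sigma> ''i'' \<and>
     distinct (s # xs) \<and> set (s # xs) = set (take (reg \<sigma> ''i'') Q) \<and>
     linked (arr \<sigma> ''nxt'') (s # xs) s \<and> grouped (\<lambda>v. L v - 1) xs)"

lemma chain_step:
  fixes L :: "nat \<Rightarrow> nat"
  defines "r \<equiv> \<lambda>v. L v - 1"
  assumes lab: "branch_labelling G s r" and Q: "distinct Q" "set Q = reach G s"
    and order: "\<And>i p. i < length Q \<Longrightarrow> p \<in> reach G s \<Longrightarrow> (p, Q ! i) \<in> parcs G \<Longrightarrow> p \<in> set (take i Q)"
    and inv: "chain_inv Q L n \<sigma>" and lt: "reg \<sigma> ''i'' < reg \<sigma> ''t''"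
  shows "\<exists>n'<n. chain_inv Q L n' (run chain_body \<sigma>)"
proof -
  define i where "i = reg \<sigma> ''i''"
  obtain xs where *: "loaded \<sigma>" "queue \<sigma> Q" "arr \<sigma> ''lab'' = L" "0 < i" "n = length Q - i"
      "distinct (s # xs)" "set (s # xs) = set (take i Q)"
      "linked (arr \<sigma> ''nxt'') (s # xs) s" "grouped r xs"
    using inv unfolding chain_inv_def i_def r_def by auto
  have i: "i < length Q"
    using lt *(2) by (simp add: queue_def i_def)
  define v where "v = Q ! i"
  have "Q ! 0 = s"
    using queue_hd(2)[OF Q(2) order] by blast
  then have vs: "v \<noteq> s"
    using i *(4) Q(1) unfolding v_def by (metis less_irrefl less_trans nth_eq_iff_index_eq)
  have "v \<notin> set (take i Q)"
    using distinct_take[OF Q(1), of "Suc i"] i by (simp add: take_Suc_conv_app_nth v_def)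
  then have v: "v \<notin> set (s # xs)"
    using *(7) by simp
  have r: "r v \<noteq> s" "r (r v) = r v" "r v = v \<or> r v \<in> set (s # xs)"
    using label_order[OF lab Q(2) order i] vs *(7) unfolding v_def by auto
  define u where "u = (if r v = v then s else r v)"
  define \<sigma>' where "\<sigma>' = run chain_body \<sigma>"
  have "v = arr \<sigma> ''q'' (reg \<sigma> ''i'')" "r v = arr \<sigma> ''lab'' v - 1"
      "u = (if r v = v then reg \<sigma> ''s'' else r v)"
    using *(1,2,3) i by (simp_all add: queue_def v_def i_def[symmetric] r_def u_def loaded_def)
  note body = run_chain_body[OF this, folded \<sigma>'_def]
  obtain xs' where xs': "distinct (s # xs')" "set (s # xs') = insert v (set (s # xs))"
      "linked ((arr \<sigma> ''nxt'')(v := arr \<sigma> ''nxt'' u, u := v)) (s # xs') s" "grouped r xs'"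
  proof (cases "r v = v")
    case True
    show ?thesis
    proof (rule that[of "v # xs"])
      show "linked ((arr \<sigma> ''nxt'')(v := arr \<sigma> ''nxt'' u, u := v)) (s # v # xs) s"
        using linked_insert[of "arr \<sigma> ''nxt''" "[]" s xs s v] *(6,8) v True by (simp add: u_def)
      show "grouped r (v # xs)"
        by (rule grouped_Cons[OF *(9) True])
    qed (use v *(6) in auto)
  next
    case False
    then have u: "u = r v" "u \<in> set xs"
      using r by (auto simp: u_def)
    then obtain ys zs where xs: "xs = ys @ u # zs" "grouped r (ys @ u # v # zs)"
      using grouped_insert[OF *(9) u(2), of v] r(2) u(1) by metis
    show ?thesis
    proof (rule that[of "ys @ u # v # zs"])
      show "linked ((arr \<sigma> ''nxt'')(v := arr \<sigma> ''nxt'' u, u := v)) (s # ys @ u # v # zs) s"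
        using linked_insert[of "arr \<sigma> ''nxt''" "s # ys" u zs s v] *(6,8) v xs(1) by simp
    qed (use v *(6) xs in auto)
  qed
  have "set (take (Suc i) Q) = insert v (set (take i Q))"
    using i by (simp add: take_Suc_conv_app_nth v_def)
  then have "chain_inv Q L (n - 1) \<sigma>'"
    unfolding chain_inv_def using xs' *(1-5,7) i
    by (intro exI[of _ xs']) (simp add: body loaded_def queue_def i_def r_def)
  then show ?thesis
    using *(5) i unfolding \<sigma>'_def by (intro exI[of _ "n - 1"]) simp
qed

lemma chain_halts:
  fixes \<sigma> :: state
  defines "L \<equiv> arr \<sigma> ''lab''"
  assumes lab: "branch_labelling G s (\<lambda>v. L v - 1)" and Q: "distinct Q" "set Q = reach G s"
    and order: "\<And>i p. i < length Q \<Longrightarrow> p \<in> reach G s \<Longrightarrow> (p, Q ! i) \<in> parcs G \<Longrightarrow> p \<in> set (take i Q)"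
    and \<sigma>: "loaded \<sigma>" "queue \<sigma> Q"
  shows "halts_within chain \<sigma> (15 * (card (parcs G) + 1)) (\<lambda>\<sigma>'. loaded \<sigma>' \<and> arr \<sigma>' ''lab'' = L \<and>
     (\<exists>xs. distinct (s # xs) \<and> set (s # xs) = reach G s \<and>
       linked (arr \<sigma>' ''nxt'') (s # xs) s \<and> grouped (\<lambda>v. L v - 1) xs))"
proof -
  let ?n = "length Q - 1"
  note hd = queue_hd[OF Q(2) order]
  have take1: "take (Suc 0) Q = [s]"
    using hd by (cases Q) auto
  define \<sigma>1 where "\<sigma>1 = run (Store ''nxt'' ''s'' ''s'' ;; Const ''i'' 1) \<sigma>"
  have \<sigma>1: "chain_inv Q L ?n \<sigma>1"
    unfolding chain_inv_def using \<sigma> hd take1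
    by (intro exI[of _ "[]"]) (auto simp: \<sigma>1_def loaded_def queue_def L_def grouped_Nil Suc_le_eq)
  have "halts_within chain \<sigma> (2 + (?n * (steps chain_body + 1) + 1))
     (\<lambda>\<sigma>'. \<not> holds (Less ''i'' ''t'') \<sigma>' \<and> (\<exists>n. chain_inv Q L n \<sigma>'))"
    unfolding chain_def
  proof (rule halts_Seq)
    show "halts_within (Store ''nxt'' ''s'' ''s'' ;; Const ''i'' 1) \<sigma> 2 (chain_inv Q L ?n)"
      by (rule halts_straight) (use \<sigma>1 in \<open>simp_all add: \<sigma>1_def\<close>)
    show "halts_within (While (Less ''i'' ''t'') chain_body) \<sigma>' (?n * (steps chain_body + 1) + 1)
        (\<lambda>\<sigma>'. \<not> holds (Less ''i'' ''t'') \<sigma>' \<and> (\<exists>n. chain_inv Q L n \<sigma>'))"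
      if "chain_inv Q L ?n \<sigma>'" for \<sigma>'
    proof (rule halts_While[where I = "chain_inv Q L", OF _ that])
      show "straight chain_body"
        by (simp add: chain_body_def)
      show "\<exists>n'<n. chain_inv Q L n' (run chain_body \<sigma>)"
        if "chain_inv Q L n \<sigma>" "holds (Less ''i'' ''t'') \<sigma>" for n \<sigma>
        using chain_step[OF lab Q order that(1)] that(2) by simp
    qed
  qed
  then show ?thesis
  proof (rule halts_mono)
    \<comment> \<open>\<open>s\<close> is placed before the loop, so the number of rounds is one
      less than the length of the queue and at most the number of arcs.\<close>
    have "length Q \<le> card (parcs G) + 1"
      using card_reach_le[OF pair_finite_arcs, of s] distinct_card[OF Q(1)] Q(2) by simp
    then have "?n \<le> card (parcs G)"
      by simp
    then show "2 + (?n * (steps chain_body + 1) + 1) \<le> 15 * (card (parcs G) + 1)"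
      by (simp add: chain_body_def)
  next
    fix \<sigma>' assume *: "\<not> holds (Less ''i'' ''t'') \<sigma>' \<and> (\<exists>n. chain_inv Q L n \<sigma>')"
    then have "reg \<sigma>' ''i'' = length Q"
      by (auto simp: chain_inv_def queue_def)
    then show "loaded \<sigma>' \<and> arr \<sigma>' ''lab'' = L \<and>
     (\<exists>xs. distinct (s # xs) \<and> set (s # xs) = reach G s \<and>
       linked (arr \<sigma>' ''nxt'') (s # xs) s \<and> grouped (\<lambda>v. L v - 1) xs)"
      using * Q(2) unfolding chain_inv_def by (metis take_all order_refl)
  qed
qed

end


section \<open>The four operations\<close>

text \<open>Index pairs in the order of printing: \<open>p i\<close> will be the position of the
  representative of the vertex at position \<open>i\<close>.\<close>

definition rows :: "(nat \<Rightarrow> nat) \<Rightarrow> nat \<Rightarrow> (nat \<times> nat) list" where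
  "rows p n = concat (map (\<lambda>i. map (\<lambda>j. (j, i)) [0..<p i]) [0..<n])"

lemma rows_Suc: "rows p (Suc n) = rows p n @ map (\<lambda>j. (j, n)) [0..<p n]"
  by (simp add: rows_def)

lemma set_rows: "set (rows p n) = {(j, i). i < n \<and> j < p i}"
  by (auto simp: rows_def)

lemma distinct_rows: "distinct (rows p n)"
proof (induction n)
  case (Suc n)
  have "inj_on (\<lambda>j. (j, n)) A" for A :: "nat set"
    by (auto simp: inj_on_def)
  then show ?case
    using Suc by (auto simp: rows_Suc set_rows distinct_map)
qed (simp add: rows_def)

lemma length_rows: "length (rows p n) = (\<Sum>i<n. p i)"
  by (induction n) (simp_all add: rows_Suc rows_def[of _ 0])

definition print_init :: com where
  "print_init = Const ''zero'' 0 ;; Const ''f'' 0 ;; Copy ''x'' ''s'' ;; Copy ''y'' ''s''"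

text \<open>For each \<open>x\<close> in the list, \<open>y\<close> runs from \<open>s\<close> up to the representative of \<open>x\<close>.\<close>

definition print_body :: com where
  "print_body = Load ''r'' ''lab'' ''x'' ;; Dec ''r'' ;;
     Cond (Equal ''y'' ''r'')
       (Load ''x'' ''nxt'' ''x'' ;; Copy ''y'' ''s'' ;; Cond (Equal ''x'' ''s'') (Const ''f'' 1) Skip)
       (Print ''y'' ''x'' ;; Load ''y'' ''nxt'' ''y'')"

definition print_op :: com where
  "print_op = print_init ;; While (Equal ''f'' ''zero'') print_body"

definition find_op :: com where
  "find_op = Load ''x'' ''lab'' ''u'' ;; Const ''zero'' 0 ;; Copy ''rep'' ''x'' ;; Dec ''rep'' ;;
     Cond (Less ''zero'' ''x'') (Const ''member'' 1) (Const ''member'' 0)"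

definition query_op :: com where
  "query_op = Load ''x'' ''lab'' ''u'' ;; Load ''y'' ''lab'' ''v'' ;; Const ''zero'' 0 ;;
     Const ''answer'' 0 ;;
     Cond (Equal ''x'' ''zero'') Skip (Cond (Equal ''y'' ''zero'') Skip
       (Cond (Equal ''x'' ''y'') Skip (Const ''answer'' 1)))"

definition mark_root :: com where
  "mark_root = Copy ''r'' ''s'' ;; Inc ''r'' ;; Store ''lab'' ''s'' ''r''"

definition build_op :: com where
  "build_op = traverse count_act ;; mark_root ;; traverse label_act ;; chain"

text \<open>40 covers the constants 9 and 9 of the traversals, 3 of \<open>mark_root\<close> and 15
  of \<open>chain\<close>.\<close>

definition build_time :: nat where
  "build_time = 2 * steps (visit count_act) + 2 * steps (visit label_act) + 40"

lemma find_halts: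
  "halts_within find_op \<sigma> 10 (\<lambda>\<sigma>'. arr \<sigma>' = arr \<sigma> \<and> reg \<sigma>' ''s'' = reg \<sigma> ''s'' \<and> out \<sigma>' = out \<sigma> \<and>
     reg \<sigma>' ''member'' = of_bool (arr \<sigma> ''lab'' (reg \<sigma> ''u'') \<noteq> 0) \<and>
     reg \<sigma>' ''rep'' = arr \<sigma> ''lab'' (reg \<sigma> ''u'') - 1)"
  by (rule halts_straight) (simp_all add: find_op_def)

lemma query_halts:
  "halts_within query_op \<sigma> 11 (\<lambda>\<sigma>'. arr \<sigma>' = arr \<sigma> \<and> reg \<sigma>' ''s'' = reg \<sigma> ''s'' \<and> out \<sigma>' = out \<sigma> \<and>
     reg \<sigma>' ''answer'' = of_bool (arr \<sigma> ''lab'' (reg \<sigma> ''u'') \<noteq> 0 \<and> arr \<sigma> ''lab'' (reg \<sigma> ''v'') \<noteq> 0 \<and>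
       arr \<sigma> ''lab'' (reg \<sigma> ''u'') \<noteq> arr \<sigma> ''lab'' (reg \<sigma> ''v'')))"
  by (rule halts_straight) (simp_all add: query_op_def)

section \<open>Correctness of the construction and of printing\<close>

context rooted_dag
begin

text \<open>A condition on the arrays alone, so it persists under queries and printing, which change
  only registers and output.\<close>

definition built :: "(vname \<Rightarrow> nat \<Rightarrow> nat) \<Rightarrow> bool" where
  "built a \<longleftrightarrow> (\<forall>v. v \<in> reach G s \<longleftrightarrow> a ''lab'' v \<noteq> 0) \<and>
     branch_labelling G s (\<lambda>v. a ''lab'' v - 1) \<and>
     (\<exists>xs. distinct (s # xs) \<and> set (s # xs) = reach G s \<and>
       linked (a ''nxt'') (s # xs) s \<and> grouped (\<lambda>v. a ''lab'' v - 1) xs)"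

lemma count_init: "count_inv [s] {} ((arr (input_state A s))(''q'' := f))"
  by (simp add: count_inv_def input_state_def)

text \<open>\<open>s\<close> is the only reachable vertex without a reachable predecessor, which
  makes \<open>[s]\<close> the right queue while no arc is handled.\<close>

lemma label_init:
  assumes "\<And>w. a ''cnt'' w = card {p \<in> reach G s. (p, w) \<in> parcs G}" "a ''lab'' = (\<lambda>_. 0)(s := Suc s)"
  shows "label_inv [s] {} (a(''q'' := f))"
proof -
  have "{s} = {w \<in> reach G s. \<forall>p\<in>reach G s. (p, w) \<notin> parcs G}"
  proof (intro equalityI subsetI)
    show "w \<in> {w \<in> reach G s. \<forall>p\<in>reach G s. (p, w) \<notin> parcs G}" if "w \<in> {s}" for w
      using that no_arc_to_root by simp
    show "w \<in> {s}" if "w \<in> {w \<in> reach G s. \<forall>p\<in>reach G s. (p, w) \<notin> parcs G}" for w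
      using that reach_pred[of w G s] by blast
  qed
  then show ?thesis
    using assms no_arc_to_root by (auto simp: label_inv_def combine_def)
qed

lemma build_halts:
  "halts_within build_op (input_state A s) (build_time * (card (parcs G) + 1))
     (\<lambda>\<sigma>. built (arr \<sigma>) \<and> reg \<sigma> ''s'' = s \<and> out \<sigma> = [])"
proof -
  let ?m = "card (parcs G) + 1"
  let ?T1 = "2 * steps (visit count_act) + 9" and ?T2 = "2 * steps (visit label_act) + 9"
  define R1 where "R1 \<sigma> \<longleftrightarrow> loaded \<sigma> \<and>
     (\<forall>w. arr \<sigma> ''cnt'' w = card {p \<in> reach G s. (p, w) \<in> parcs G}) \<and> arr \<sigma> ''lab'' = (\<lambda>_. 0)" for \<sigma>
  define R2 where "R2 \<sigma> \<longleftrightarrow> loaded \<sigma> \<and> (\<forall>f. label_inv [s] {} ((arr \<sigma>)(''q'' := f)))" for \<sigma>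
  define R3 where "R3 \<sigma> \<longleftrightarrow> loaded \<sigma> \<and>
     (\<exists>Q. label_inv Q {(x, w) \<in> parcs G. x \<in> set Q} (arr \<sigma>) \<and> queue \<sigma> Q)" for \<sigma>
  have "loaded (input_state A s)"
    by (simp add: loaded_def input_state_def)
  from traverse_halts[OF count_ok count_init this]
  have 1: "halts_within (traverse count_act) (input_state A s) (?T1 * ?m) R1"
    by (rule halts_mono) (auto simp: R1_def dest: count_final)
  have 2: "halts_within mark_root \<sigma> 3 R2" if "R1 \<sigma>" for \<sigma>
  proof (rule halts_straight)
    have "loaded (run mark_root \<sigma>)"
      using that by (simp add: R1_def loaded_def mark_root_def)
    moreover have "label_inv [s] {} ((arr (run mark_root \<sigma>))(''q'' := f))" for f
      by (rule label_init) (use that in \<open>simp_all add: R1_def loaded_def mark_root_def fun_eq_iff\<close>)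
    ultimately show "R2 (run mark_root \<sigma>)"
      by (simp add: R2_def)
  qed (simp_all add: mark_root_def)
  have 3: "halts_within (traverse label_act) \<sigma> (?T2 * ?m) R3" if "R2 \<sigma>" for \<sigma>
    unfolding R3_def by (rule traverse_halts[OF label_ok]) (use that in \<open>simp_all add: R2_def\<close>)
  have 4: "halts_within chain \<sigma> (15 * ?m) (\<lambda>\<sigma>. built (arr \<sigma>) \<and> reg \<sigma> ''s'' = s \<and> out \<sigma> = [])"
    if R3: "R3 \<sigma>" for \<sigma>
  proof -
    obtain Q where l: "loaded \<sigma>" and I: "label_inv Q {(x, w) \<in> parcs G. x \<in> set Q} (arr \<sigma>)"
        and q: "queue \<sigma> Q"
      using R3 by (auto simp: R3_def)
    have Q: "distinct Q" "\<And>i p. i < length Q \<Longrightarrow> p \<in> reach G s \<Longrightarrow> (p, Q ! i) \<in> parcs G \<Longrightarrow> p \<in> set (take i Q)"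
      using I by (auto simp: label_inv_def)
    note final = label_final[OF I]
    show ?thesis
    proof (rule halts_mono[OF chain_halts[OF final(3) Q(1) final(1) Q(2) l q] order_refl])
      fix \<sigma>'
      assume *: "loaded \<sigma>' \<and> arr \<sigma>' ''lab'' = arr \<sigma> ''lab'' \<and>
        (\<exists>xs. distinct (s # xs) \<and> set (s # xs) = reach G s \<and>
          linked (arr \<sigma>' ''nxt'') (s # xs) s \<and> grouped (\<lambda>v. arr \<sigma> ''lab'' v - 1) xs)"
      then have "built (arr \<sigma>')"
        unfolding built_def using final(2,3) by metis
      then show "built (arr \<sigma>') \<and> reg \<sigma>' ''s'' = s \<and> out \<sigma>' = []"
        using * by (simp add: loaded_def)
    qed
  qed
  have "halts_within build_op (input_state A s) (?T1 * ?m + (3 + (?T2 * ?m + 15 * ?m)))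
      (\<lambda>\<sigma>. built (arr \<sigma>) \<and> reg \<sigma> ''s'' = s \<and> out \<sigma> = [])"
    unfolding build_op_def by (intro halts_Seq[OF 1] halts_Seq[OF 2] halts_Seq[OF 3] 4)
  then show ?thesis
    by (rule halts_mono) (simp_all add: build_time_def algebra_simps)
qed

lemma built_junction_iff:
  assumes "built a"
  shows "junction G s u v \<longleftrightarrow> a ''lab'' u \<noteq> 0 \<and> a ''lab'' v \<noteq> 0 \<and> a ''lab'' u \<noteq> a ''lab'' v"
proof -
  have lab: "branch_labelling G s (\<lambda>v. a ''lab'' v - 1)"
    and reach: "\<And>v. v \<in> reach G s \<longleftrightarrow> a ''lab'' v \<noteq> 0"
    using assms by (auto simp: built_def)
  show ?thesis
    unfolding junction_iff_label_neq[OF root_in lab] reach by auto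
qed

lemma built_list:
  assumes "built a"
  obtains xs where "distinct xs" "set xs = reach G s" "xs ! 0 = s" "xs \<noteq> []" "linked (a ''nxt'') xs s"
    "grouped (\<lambda>v. a ''lab'' v - 1) xs"
proof -
  obtain xs where xs: "distinct (s # xs)" "set (s # xs) = reach G s"
       "linked (a ''nxt'') (s # xs) s" "grouped (\<lambda>v. a ''lab'' v - 1) xs"
    using assms by (auto simp: built_def)
  have "a ''lab'' s - 1 = s"
    using assms by (simp add: built_def branch_labelling_def)
  from grouped_Cons[OF xs(4) this] show thesis
    using xs(1-3) by (intro that[of "s # xs"]) auto
qed

lemma print_halts:
  assumes built: "built (arr \<sigma>)" and root: "reg \<sigma> ''s'' = s"
  shows "halts_within print_op \<sigma> (40 * (card (junction_pairs G s) + 1))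
     (\<lambda>\<sigma>'. arr \<sigma>' = arr \<sigma> \<and> reg \<sigma>' ''s'' = s \<and> (\<exists>L. out \<sigma>' = out \<sigma> @ L \<and>
        distinct (map (\<lambda>(u, v). {u, v}) L) \<and> set (map (\<lambda>(u, v). {u, v}) L) = junction_pairs G s))"
proof -
  define L where "L = arr \<sigma> ''lab''"
  define r where "r = (\<lambda>v. L v - 1)"
  have pos: "v \<in> reach G s \<longleftrightarrow> L v \<noteq> 0" for v
    using built by (simp add: built_def L_def)
  obtain xs where xs: "distinct xs" "set xs = reach G s" "xs ! 0 = s" "xs \<noteq> []"
      "linked (arr \<sigma> ''nxt'') xs s" "grouped r xs"
    using built_list[OF built] unfolding L_def r_def by metis
  let ?n = "length xs"
  have "\<forall>i. \<exists>p. i < ?n \<longrightarrow> p \<le> i \<and> xs ! p = r (xs ! i) \<and> (\<forall>j. p \<le> j \<longrightarrow> j \<le> i \<longrightarrow> r (xs ! j) = r (xs ! i))"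
    by (metis grouped_nth[OF xs(6,1)])
  then obtain p where p: "\<And>i. i < ?n \<Longrightarrow> p i \<le> i" "\<And>i. i < ?n \<Longrightarrow> xs ! p i = r (xs ! i)"
      "\<And>i j. i < ?n \<Longrightarrow> p i \<le> j \<Longrightarrow> j \<le> i \<Longrightarrow> r (xs ! j) = r (xs ! i)"
    by metis
  \<comment> \<open>Positions from \<open>p i\<close> to \<open>i\<close> share one block. A
    position \<open>j < p i\<close> has its representative at \<open>p j <= j < p i\<close>, hence a
    different one.\<close>
  have before: "r (xs ! j) \<noteq> r (xs ! i) \<longleftrightarrow> j < p i" if "j < i" "i < ?n" for i j
  proof
    assume "r (xs ! j) \<noteq> r (xs ! i)"
    then show "j < p i"
      using p(3)[OF that(2), of j] that(1) by force
  next
    assume "j < p i"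
    moreover have "p j \<le> j"
      using p(1) that by simp
    moreover have "p i < ?n"
      using p(1)[of i] that by simp
    ultimately have "xs ! p j \<noteq> xs ! p i"
      using xs(1) that by (simp add: nth_eq_iff_index_eq)
    then show "r (xs ! j) \<noteq> r (xs ! i)"
      using p(2) that by simp
  qed
  define pair where "pair = (\<lambda>(j, i). (xs ! j, xs ! i))"
  define M where "M = map pair (rows p ?n)"
  have rows: "set (rows p ?n) = {(j, i). i < ?n \<and> j < i \<and> r (xs ! j) \<noteq> r (xs ! i)}"
  proof -
    have "j < p i \<longleftrightarrow> j < i \<and> r (xs ! j) \<noteq> r (xs ! i)" if "i < ?n" for i j
      using before[OF _ that, of j] p(1)[OF that] by (cases "j < i") auto
    then show ?thesis
      by (auto simp: set_rows)
  qed
  \<comment> \<open>The order \<open>j < i\<close> selects one orientation, so no unordered pair is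
    printed twice.\<close>
  have inj: "inj_on (\<lambda>(j, i). {xs ! j, xs ! i}) {(j, i). i < ?n \<and> j < i}"
    using xs(1) by (auto simp: inj_on_def doubleton_eq_iff nth_eq_iff_index_eq)
  have map_M: "map (\<lambda>(u, v). {u, v}) M = map (\<lambda>(j, i). {xs ! j, xs ! i}) (rows p ?n)"
    by (simp add: M_def pair_def comp_def case_prod_beta)
  have dist: "distinct (map (\<lambda>(u, v). {u, v}) M)"
    unfolding map_M distinct_map
    by (intro conjI distinct_rows inj_on_subset[OF inj]) (auto simp: rows)
  have junction: "junction G s u v \<longleftrightarrow> u \<in> set xs \<and> v \<in> set xs \<and> r u \<noteq> r v" for u v
    unfolding built_junction_iff[OF built] xs(2) pos r_def by (auto simp: L_def)
  have set_M: "set (map (\<lambda>(u, v). {u, v}) M) = junction_pairs G s"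
  proof (intro equalityI subsetI)
    fix e assume "e \<in> set (map (\<lambda>(u, v). {u, v}) M)"
    then obtain j i where "(j, i) \<in> set (rows p ?n)" "e = {xs ! j, xs ! i}"
      unfolding map_M by auto
    moreover from this have "junction G s (xs ! j) (xs ! i)"
      by (simp add: rows junction)
    ultimately show "e \<in> junction_pairs G s"
      unfolding junction_pairs_def by blast
  next
    fix e assume "e \<in> junction_pairs G s"
    then obtain u v where uv: "e = {u, v}" "u \<in> set xs" "v \<in> set xs" "r u \<noteq> r v"
      by (auto simp: junction_pairs_def junction)
    then obtain j i where ji: "e = {xs ! j, xs ! i}" "j < ?n" "i < ?n" "r (xs ! j) \<noteq> r (xs ! i)"
      by (metis in_set_conv_nth)
    then have "(j, i) \<in> set (rows p ?n) \<or> (i, j) \<in> set (rows p ?n)"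
      unfolding rows by (cases i j rule: linorder_cases) auto
    then show "e \<in> set (map (\<lambda>(u, v). {u, v}) M)"
      unfolding map_M using ji(1) by (force simp: insert_commute)
  qed
  have k: "(\<Sum>i<?n. p i) = card (junction_pairs G s)"
    using distinct_card[OF dist] unfolding set_M by (simp add: M_def length_rows)

  \<comment> \<open>Rounds remaining from row \<open>i\<close> on: one per pair to be printed and
    one to leave each row.\<close>
  define left where "left i = (\<Sum>i'\<in>{i..<?n}. Suc (p i'))" for i
  have left: "left i = Suc (p i) + left (Suc i)" if "i < ?n" for i
    using that by (simp add: left_def sum.atLeast_Suc_lessThan)
  have left_end: "left ?n = 0"
    by (simp add: left_def)
  have "?n \<le> card (junction_pairs G s) + 1"
  proof -
    \<comment> \<open>Position 0 holds \<open>s\<close>, whose label differs from all others. So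
      every later row prints a pair, and leaving the rows is paid for by the output.\<close>
    have "1 \<le> p i" if "0 < i" "i < ?n" for i
    proof -
      have lab: "branch_labelling G s r"
        using built unfolding built_def L_def r_def by blast
      then have "r s = s"
        by (simp add: branch_labelling_def)
      moreover have "xs ! i \<in> reach G s"
        using xs(2) that(2) nth_mem by blast
      moreover have "xs ! i \<noteq> s"
        using xs(1,3,4) that by (metis length_greater_0_conv less_irrefl nth_eq_iff_index_eq)
      ultimately have "r (xs ! 0) \<noteq> r (xs ! i)"
        using label_neq_root[OF root_in lab] xs(3) by metis
      then show ?thesis
        using before[OF that] by simp
    qed
    then have "(\<Sum>i\<in>{1..<?n}. 1) \<le> (\<Sum>i\<in>{1..<?n}. p i)"
      by (intro sum_mono) auto
    also have "\<dots> \<le> (\<Sum>i<?n. p i)"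
      by (intro sum_mono2) auto
    finally show ?thesis using k by simp
  qed
  then have time: "left 0 \<le> 2 * card (junction_pairs G s) + 1"
    using k by (simp add: left_def sum.distrib atLeast0LessThan sum_Suc)

  \<comment> \<open>Within row \<open>i\<close> the variant is \<open>left i\<close> less the
    \<open>j\<close> pairs already printed there.\<close>
  define I where "I n \<tau> \<longleftrightarrow> arr \<tau> = arr \<sigma> \<and> reg \<tau> ''s'' = s \<and> reg \<tau> ''zero'' = 0 \<and>
     (reg \<tau> ''f'' = 1 \<and> n = 0 \<and> out \<tau> = out \<sigma> @ M \<or>
      (\<exists>i j. reg \<tau> ''f'' = 0 \<and> i < ?n \<and> j \<le> p i \<and> reg \<tau> ''x'' = xs ! i \<and> reg \<tau> ''y'' = xs ! j \<and>
        out \<tau> = out \<sigma> @ map pair (rows p i @ map (\<lambda>j. (j, i)) [0..<j]) \<and> n + j = left i))" for n and \<tau> :: state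
  \<comment> \<open>The link from the last element back to \<open>s\<close> is how the loop
    recognizes its end.\<close>
  have next_i: "arr \<sigma> ''nxt'' (xs ! i) = (if Suc i < ?n then xs ! Suc i else s)" if "i < ?n" for i
    using linked_nth[OF xs(5) that] that by (simp add: nth_append)
  have step: "\<exists>n'<n. I n' (run print_body \<tau>)" if I: "I n \<tau>" and f: "holds (Equal ''f'' ''zero'') \<tau>" for n \<tau>
  proof -
    obtain i j where *: "arr \<tau> = arr \<sigma>" "reg \<tau> ''s'' = s" "reg \<tau> ''zero'' = 0" "reg \<tau> ''f'' = 0"
        "i < ?n" "j \<le> p i" "reg \<tau> ''x'' = xs ! i" "reg \<tau> ''y'' = xs ! j"
        "out \<tau> = out \<sigma> @ map pair (rows p i @ map (\<lambda>j. (j, i)) [0..<j])" "n + j = left i"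
      using I f by (auto simp: I_def)
    have j: "j < ?n" "p i < ?n"
      using *(5,6) p(1)[of i] by auto
    have r: "arr \<tau> ''lab'' (xs ! i) - 1 = xs ! p i"
      using p(2)[OF *(5)] *(1) by (simp add: r_def L_def)
    show ?thesis
    proof (cases "j = p i")
      case False
      then have "xs ! j \<noteq> xs ! p i"
        using xs(1) j by (simp add: nth_eq_iff_index_eq)
      moreover have "j < p i" "j < i" using False *(5,6) p(1)[of i] by auto
      ultimately have "I (n - 1) (run print_body \<tau>)"
        using * r next_i[OF j(1)] left[OF *(5)] unfolding I_def
        by (intro conjI disjI2 exI[of _ i] exI[of _ "Suc j"]) (auto simp: print_body_def pair_def)
      moreover have "n \<noteq> 0"
        using *(10) left[OF *(5)] \<open>j < p i\<close> by simp
      ultimately show ?thesis by (intro exI[of _ "n - 1"]) auto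
    next
      case True
      then have out: "out \<tau> = out \<sigma> @ map pair (rows p (Suc i))"
        using *(9) by (simp add: rows_Suc)
      show ?thesis
      proof (cases "Suc i < ?n")
        case last: True
        have "xs ! Suc i \<noteq> s"
          using xs(1,3,4) last by (metis Zero_not_Suc length_greater_0_conv nth_eq_iff_index_eq)
        then have "I (left (Suc i)) (run print_body \<tau>)"
          using * r next_i[OF *(5)] last True out xs(3) unfolding I_def
          by (intro conjI disjI2 exI[of _ "Suc i"] exI[of _ 0]) (auto simp: print_body_def)
        then show ?thesis
          using *(10) left[OF *(5)] True by (intro exI[of _ "left (Suc i)"]) auto
      next
        case False
        then have "Suc i = ?n" using *(5) by simp
        then have "I 0 (run print_body \<tau>)"
          using * r next_i[OF *(5)] True out unfolding I_def
          by (intro conjI disjI1) (auto simp: print_body_def M_def)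
        then show ?thesis
          using *(10) left[OF *(5)] True by (intro exI[of _ 0]) auto
      qed
    qed
  qed
  have "halts_within print_op \<sigma> (4 + (left 0 * (steps print_body + 1) + 1))
      (\<lambda>\<tau>. \<not> holds (Equal ''f'' ''zero'') \<tau> \<and> (\<exists>n. I n \<tau>))"
    unfolding print_op_def
  proof (rule halts_Seq)
    have "I (left 0) (run print_init \<sigma>)"
      using root xs(3,4) unfolding I_def
      by (intro conjI disjI2 exI[of _ 0] exI[of _ 0]) (auto simp: print_init_def rows_def)
    then show "halts_within print_init \<sigma> 4 (I (left 0))"
      by (intro halts_straight) (simp_all add: print_init_def)
    show "halts_within (While (Equal ''f'' ''zero'') print_body) \<tau> (left 0 * (steps print_body + 1) + 1)
        (\<lambda>\<tau>. \<not> holds (Equal ''f'' ''zero'') \<tau> \<and> (\<exists>n. I n \<tau>))" if "I (left 0) \<tau>" for \<tau>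
      by (rule halts_While[where I = I, OF _ that step]) (simp_all add: print_body_def)
  qed
  then show ?thesis
  proof (rule halts_mono)
    show "4 + (left 0 * (steps print_body + 1) + 1) \<le> 40 * (card (junction_pairs G s) + 1)"
      using time by (simp add: print_body_def)
    show "arr \<tau> = arr \<sigma> \<and> reg \<tau> ''s'' = s \<and> (\<exists>L. out \<tau> = out \<sigma> @ L \<and>
        distinct (map (\<lambda>(u, v). {u, v}) L) \<and> set (map (\<lambda>(u, v). {u, v}) L) = junction_pairs G s)"
      if "\<not> holds (Equal ''f'' ''zero'') \<tau> \<and> (\<exists>n. I n \<tau>)" for \<tau>
      using that dist set_M unfolding I_def by auto
  qed
qed

end

text \<open>The representative heads the block of \<open>v\<close>, where the decremented entry is
  the same; both entries are positive and therefore agree before the decrement.\<close>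

lemma (in rooted_dag) built_rep:
  assumes "built a" "v \<in> reach G s"
  shows "a ''lab'' v - 1 \<in> reach G s" "a ''lab'' (a ''lab'' v - 1) = a ''lab'' v"
proof -
  obtain xs where xs: "distinct xs" "set xs = reach G s" "grouped (\<lambda>v. a ''lab'' v - 1) xs"
    using built_list[OF assms(1)] by metis
  then obtain i where i: "i < length xs" "v = xs ! i"
    using assms(2) by (metis in_set_conv_nth)
  obtain p where p: "p \<le> i" "xs ! p = a ''lab'' v - 1" "a ''lab'' (xs ! p) - 1 = a ''lab'' v - 1"
    using grouped_nth[OF xs(3,1) i(1)] i(2) by (metis order_refl)
  then show reach: "a ''lab'' v - 1 \<in> reach G s"
    using xs(2) i(1) by (metis le_less_trans nth_mem)
  have "a ''lab'' w \<noteq> 0" if "w \<in> reach G s" for w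
    using assms(1) that by (auto simp: built_def)
  then show "a ''lab'' (a ''lab'' v - 1) = a ''lab'' v"
    using p(2,3) reach assms(2) by (metis One_nat_def Suc_pred neq0_conv)
qed

lemma (in rooted_dag) built_partition:
  assumes built: "built a"
  defines "P \<equiv> (\<lambda>v. {w \<in> reach G s. a ''lab'' w = a ''lab'' v}) ` reach G s"
    and "rep \<equiv> \<lambda>B. a ''lab'' (SOME v. v \<in> B) - 1"
  shows "10 \<le> c \<Longrightarrow> stores_partition find_op c {\<sigma> :: state. arr \<sigma> = a \<and> reg \<sigma> ''s'' = s} (pverts G) (reach G s) P rep"
    and "junction G s u v \<longleftrightarrow> (\<exists>B\<in>P. \<exists>C\<in>P. u \<in> B \<and> v \<in> C \<and> B \<noteq> C)"
proof -
  let ?L = "a ''lab''"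
  have pos: "v \<in> reach G s \<longleftrightarrow> ?L v \<noteq> 0" for v
    using built by (simp add: built_def)
  \<comment> \<open>All members of a block share one entry, so any choice made by
    \<open>SOME\<close> yields the same representative.\<close>
  have rep: "rep B = ?L v - 1" if B: "B \<in> P" and v: "v \<in> B" for B v
  proof -
    have "(SOME v. v \<in> B) \<in> B"
      using v by (rule someI)
    then have "?L (SOME v. v \<in> B) = ?L v"
      using B v by (auto simp: P_def)
    then show ?thesis by (simp add: rep_def)
  qed
  show "stores_partition find_op c {\<sigma> :: state. arr \<sigma> = a \<and> reg \<sigma> ''s'' = s} (pverts G) (reach G s) P rep"
    if c: "10 \<le> c"
    unfolding stores_partition_def
  proof (intro conjI ballI)
    show "partition_on (reach G s) P"
      by (rule partition_onI) (auto simp: P_def disjnt_def)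
    show "rep B \<in> B" if B: "B \<in> P" for B
    proof -
      obtain v where v: "v \<in> reach G s" "B = {w \<in> reach G s. ?L w = ?L v}"
        using B by (auto simp: P_def)
      then have "rep B = ?L v - 1"
        using rep[OF B, of v] by simp
      then show ?thesis
        using v built_rep[OF built v(1)] by simp
    qed
    fix \<sigma> :: state and v assume "\<sigma> \<in> {\<sigma> :: state. arr \<sigma> = a \<and> reg \<sigma> ''s'' = s}" "v \<in> pverts G"
    then show "halts_within find_op (set_reg ''u'' v \<sigma>) c (\<lambda>\<sigma>'.
        \<sigma>' \<in> {\<sigma> :: state. arr \<sigma> = a \<and> reg \<sigma> ''s'' = s} \<and> out \<sigma>' = out \<sigma> \<and>
        reg \<sigma>' ''member'' = of_bool (v \<in> reach G s) \<and> (\<forall>B\<in>P. v \<in> B \<longrightarrow> reg \<sigma>' ''rep'' = rep B))"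
      by (intro halts_mono[OF find_halts c]) (auto simp: pos rep)
  qed (rule reach_subset)
  show "junction G s u v \<longleftrightarrow> (\<exists>B\<in>P. \<exists>C\<in>P. u \<in> B \<and> v \<in> C \<and> B \<noteq> C)"
    unfolding built_junction_iff[OF built] P_def pos[symmetric] by auto
qed

theorem theorem1:
  shows "\<exists>(build_op :: com) (find_op :: com) (query_op :: com) (print_op :: com) (c :: nat).
    \<forall>(G :: nat pair_pre_digraph) (A :: nat list list) (s :: nat).
      dag G \<and> adjacency_lists G A \<and> s \<in> pverts G \<longrightarrow>
      (\<exists>(S :: state set) (D :: nat set) (P :: nat set set) (rep :: nat set \<Rightarrow> nat).
         halts_within build_op (input_state A s) (c * (card (parcs G) + 1))
           (\<lambda>\<sigma>. \<sigma> \<in> S \<and> out \<sigma> = []) \<and>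
         stores_partition find_op c S (pverts G) D P rep \<and>
         (\<forall>u\<in>pverts G. \<forall>v\<in>pverts G.
            junction G s u v \<longleftrightarrow> (\<exists>B\<in>P. \<exists>C\<in>P. u \<in> B \<and> v \<in> C \<and> B \<noteq> C)) \<and>
         (\<forall>\<sigma>\<in>S. \<forall>u\<in>pverts G. \<forall>v\<in>pverts G.
            halts_within query_op (set_reg ''u'' u (set_reg ''v'' v \<sigma>)) c
              (\<lambda>\<sigma>'. \<sigma>' \<in> S \<and> out \<sigma>' = out \<sigma> \<and>
                    reg \<sigma>' ''answer'' = of_bool (junction G s u v))) \<and>
         (\<forall>\<sigma>\<in>S. halts_within print_op \<sigma> (c * (card (junction_pairs G s) + 1))
            (\<lambda>\<sigma>'. \<sigma>' \<in> S \<and>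
               (\<exists>L. out \<sigma>' = out \<sigma> @ L \<and>
                    distinct (map (\<lambda>(u, v). {u, v}) L) \<and>
                    set (map (\<lambda>(u, v). {u, v}) L) = junction_pairs G s))))"
proof (rule exI[of _ build_op], rule exI[of _ find_op], rule exI[of _ query_op],
    rule exI[of _ print_op], rule exI[of _ "build_time + 40"], intro allI impI)
  fix G :: "nat pair_pre_digraph" and A :: "nat list list" and s :: nat
  assume *: "dag G \<and> adjacency_lists G A \<and> s \<in> pverts G"
  interpret dag G
    using * by blast
  interpret rooted_dag G A s
    by unfold_locales (use * in auto)
  \<comment> \<open>40 is the constant for printing and exceeds 10 and 11, the constants of
    \<open>find_op\<close> and \<open>query_op\<close>.\<close>
  let ?c = "build_time + 40"
  obtain \<sigma>0 t where \<sigma>0: "exec build_op (input_state A s) t \<sigma>0" "t \<le> build_time * (card (parcs G) + 1)"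
      "built (arr \<sigma>0)" "reg \<sigma>0 ''s'' = s" "out \<sigma>0 = []"
    using build_halts unfolding halts_within_def by blast
  define a where "a = arr \<sigma>0"
  \<comment> \<open>The arrays left by the construction and the root are fixed, while the other
    registers and the output stay free; all later operations remain in \<open>S\<close>.\<close>
  define S where "S = {\<sigma> :: state. arr \<sigma> = a \<and> reg \<sigma> ''s'' = s}"
  define P where "P = (\<lambda>v. {w \<in> reach G s. a ''lab'' w = a ''lab'' v}) ` reach G s"
  define rep where "rep = (\<lambda>B. a ''lab'' (SOME v. v \<in> B) - 1)"
  have built: "built a"
    using \<sigma>0(3) by (simp add: a_def)
  note part = built_partition[OF built, folded P_def rep_def S_def]
  have 1: "halts_within build_op (input_state A s) (?c * (card (parcs G) + 1)) (\<lambda>\<sigma>. \<sigma> \<in> S \<and> out \<sigma> = [])"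
  proof -
    have "t \<le> ?c * (card (parcs G) + 1)"
      using \<sigma>0(2) by (simp add: add_mult_distrib)
    moreover have "\<sigma>0 \<in> S"
      using \<sigma>0(4) by (simp add: S_def a_def)
    ultimately show ?thesis
      unfolding halts_within_def using \<sigma>0(1,5) by blast
  qed
  have 2: "stores_partition find_op ?c S (pverts G) (reach G s) P rep"
    by (rule part(1)) simp
  have 3: "\<forall>u\<in>pverts G. \<forall>v\<in>pverts G.
      junction G s u v \<longleftrightarrow> (\<exists>B\<in>P. \<exists>C\<in>P. u \<in> B \<and> v \<in> C \<and> B \<noteq> C)"
    using part(2) by blast
  have 4: "halts_within query_op (set_reg ''u'' u (set_reg ''v'' v \<sigma>)) ?c
      (\<lambda>\<sigma>'. \<sigma>' \<in> S \<and> out \<sigma>' = out \<sigma> \<and> reg \<sigma>' ''answer'' = of_bool (junction G s u v))"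
    if "\<sigma> \<in> S" for \<sigma> u v
    unfolding built_junction_iff[OF built]
    by (rule halts_mono[OF query_halts]) (use that in \<open>auto simp: S_def\<close>)
  have 5: "halts_within print_op \<sigma> (?c * (card (junction_pairs G s) + 1))
      (\<lambda>\<sigma>'. \<sigma>' \<in> S \<and> (\<exists>L. out \<sigma>' = out \<sigma> @ L \<and> distinct (map (\<lambda>(u, v). {u, v}) L) \<and>
         set (map (\<lambda>(u, v). {u, v}) L) = junction_pairs G s))" if "\<sigma> \<in> S" for \<sigma>
  proof (rule halts_mono[OF print_halts])
    show "built (arr \<sigma>)" "reg \<sigma> ''s'' = s"
      using that built by (simp_all add: S_def)
    show "40 * (card (junction_pairs G s) + 1) \<le> ?c * (card (junction_pairs G s) + 1)"
      by (intro mult_le_mono1) simp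
  qed (use that in \<open>simp add: S_def\<close>)
  show "\<exists>S D P rep.
      halts_within build_op (input_state A s) (?c * (card (parcs G) + 1)) (\<lambda>\<sigma>. \<sigma> \<in> S \<and> out \<sigma> = []) \<and>
      stores_partition find_op ?c S (pverts G) D P rep \<and>
      (\<forall>u\<in>pverts G. \<forall>v\<in>pverts G.
         junction G s u v \<longleftrightarrow> (\<exists>B\<in>P. \<exists>C\<in>P. u \<in> B \<and> v \<in> C \<and> B \<noteq> C)) \<and>
      (\<forall>\<sigma>\<in>S. \<forall>u\<in>pverts G. \<forall>v\<in>pverts G.
         halts_within query_op (set_reg ''u'' u (set_reg ''v'' v \<sigma>)) ?c
           (\<lambda>\<sigma>'. \<sigma>' \<in> S \<and> out \<sigma>' = out \<sigma> \<and> reg \<sigma>' ''answer'' = of_bool (junction G s u v))) \<and>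
      (\<forall>\<sigma>\<in>S. halts_within print_op \<sigma> (?c * (card (junction_pairs G s) + 1))
         (\<lambda>\<sigma>'. \<sigma>' \<in> S \<and> (\<exists>L. out \<sigma>' = out \<sigma> @ L \<and> distinct (map (\<lambda>(u, v). {u, v}) L) \<and>
            set (map (\<lambda>(u, v). {u, v}) L) = junction_pairs G s)))"
    by (intro exI[of _ S] exI[of _ "reach G s"] exI[of _ P] exI[of _ rep] conjI ballI 1 2 3[rule_format] 4 5)
qed

end
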